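(* Let $G$ be a finitely generated $2$-step nilpotent group with infinite cyclic derived subgroup (a generalised Heisenberg group), and let $\psi$ be any automorphism of $G$. Then $$\mathrm{Gr}_{\psi,G}(n)\prec \mathrm{Gr}_{\sim G}(n).$$
   Context: A group $G$ is $2$-step nilpotent if $[G,G]\subset Z(G)$. For a finite generating set $S$ of $G$, $\|g\|_S$ is the word norm with respect to $S\cup S^{-1}$. For an automorphism $\psi$ of $G$, $x\sim_\psi y$ means $gx\psi(g)^{-1}=y$ for some $g\in G$; $[x]_\psi$ is the class of $x$; the twisted conjugacy growth function is $\mathrm{Gr}^S_{\psi,G}(n)=\#\{[g]_\psi: g\in G,\|g\|_S\le n\}$. The conjugacy growth function $\mathrm{Gr}^S_{\sim G}(n)$ is the number of conjugacy classes of $G$ meeting $\{g:\|g\|_S\le n\}$, i.e. $\mathrm{Gr}^S_{\mathrm{id},G}(n)$. For non-decreasing $f,g:\mathbb N_{>0}\to\mathbb R_{>0}$, $f\prec g$ means there is a natural $c\ge1$ with $f(n)\le c\,g(cn)$ for all $n\ge1$; $f\simeq g$ means $f\prec g$ and $g\prec f$. Up to $\simeq$ these functions do not depend on $S$, so $S$ is dropped from the notation. *)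

theory Defs
  imports Complex_Main "HOL-Algebra.Generated_Groups" "HOL-Algebra.Elementary_Groups"
begin

definition group_center :: "('a, 'b) monoid_scheme \<Rightarrow> 'a set" where
  "group_center G = {z \<in> carrier G. \<forall>g \<in> carrier G. z \<otimes>\<^bsub>G\<^esub> g = g \<otimes>\<^bsub>G\<^esub> z}"

definition two_step_nilpotent :: "('a, 'b) monoid_scheme \<Rightarrow> bool" where
  "two_step_nilpotent G \<longleftrightarrow> derived G (carrier G) \<subseteq> group_center G"

definition infinite_cyclic_group :: "('a, 'b) monoid_scheme \<Rightarrow> bool" where
  "infinite_cyclic_group G \<longleftrightarrow> cyclic_group G \<and> infinite (carrier G)"

definition finite_generating_set :: "('a, 'b) monoid_scheme \<Rightarrow> 'a set \<Rightarrow> bool" where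
  "finite_generating_set G S \<longleftrightarrow> finite S \<and> S \<subseteq> carrier G \<and> generate G S = carrier G"

text \<open>The word norm is meaningful only for elements of the subgroup generated by \<open>S\<close>;
  below it is used for generating sets \<open>S\<close> only.\<close>

definition word_norm :: "('a, 'b) monoid_scheme \<Rightarrow> 'a set \<Rightarrow> 'a \<Rightarrow> nat" where
  "word_norm G S g = (LEAST k. \<exists>ws. set ws \<subseteq> S \<union> m_inv G ` S \<and> length ws = k
                                  \<and> foldr (\<otimes>\<^bsub>G\<^esub>) ws \<one>\<^bsub>G\<^esub> = g)"

definition word_ball :: "('a, 'b) monoid_scheme \<Rightarrow> 'a set \<Rightarrow> nat \<Rightarrow> 'a set" where
  "word_ball G S n = {g \<in> carrier G. word_norm G S g \<le> n}"

definition twisted_class :: "('a, 'b) monoid_scheme \<Rightarrow> ('a \<Rightarrow> 'a) \<Rightarrow> 'a \<Rightarrow> 'a set" where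
  "twisted_class G \<psi> x = {y \<in> carrier G. \<exists>g \<in> carrier G. g \<otimes>\<^bsub>G\<^esub> x \<otimes>\<^bsub>G\<^esub> inv\<^bsub>G\<^esub> (\<psi> g) = y}"

definition twisted_growth ::
    "('a, 'b) monoid_scheme \<Rightarrow> 'a set \<Rightarrow> ('a \<Rightarrow> 'a) \<Rightarrow> nat \<Rightarrow> nat" where
  "twisted_growth G S \<psi> n = card (twisted_class G \<psi> ` word_ball G S n)"

definition conjugacy_class :: "('a, 'b) monoid_scheme \<Rightarrow> 'a \<Rightarrow> 'a set" where
  "conjugacy_class G x = {g \<otimes>\<^bsub>G\<^esub> x \<otimes>\<^bsub>G\<^esub> inv\<^bsub>G\<^esub> g | g. g \<in> carrier G}"

definition conjugacy_growth :: "('a, 'b) monoid_scheme \<Rightarrow> 'a set \<Rightarrow> nat \<Rightarrow> nat" where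
  "conjugacy_growth G S n =
     card {C \<in> conjugacy_class G ` carrier G. C \<inter> word_ball G S n \<noteq> {}}"

text \<open>Growth functions live on the positive integers, so their value at \<open>0\<close> is ignored.\<close>

definition growth_le :: "(nat \<Rightarrow> real) \<Rightarrow> (nat \<Rightarrow> real) \<Rightarrow> bool"  (infix \<open>\<prec>\<close> 50) where
  "f \<prec> g \<longleftrightarrow> (\<exists>c::nat. c \<ge> 1 \<and> (\<forall>n\<ge>1. f n \<le> real c * g (c * n)))"

context group
begin

lemma twisted_class_id:
  assumes "x \<in> carrier G"
  shows "twisted_class G id x = conjugacy_class G x"
  using assms unfolding twisted_class_def conjugacy_class_def by auto

lemma conjugacy_class_self:
  assumes "x \<in> carrier G"
  shows "x \<in> conjugacy_class G x"
  using assms unfolding conjugacy_class_def by (force intro: exI[of _ "\<one>"])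

lemma conjugacy_class_eq:
  assumes x: "x \<in> carrier G" and y: "y \<in> conjugacy_class G x"
  shows "conjugacy_class G y = conjugacy_class G x"
proof -
  obtain g where g: "g \<in> carrier G" and yg: "y = g \<otimes> x \<otimes> inv g"
    using y unfolding conjugacy_class_def by blast
  have a: "h \<otimes> y \<otimes> inv h = (h \<otimes> g) \<otimes> x \<otimes> inv (h \<otimes> g)" if "h \<in> carrier G" for h
    using that g x by (simp add: yg m_assoc inv_mult_group)
  have b: "h \<otimes> x \<otimes> inv h = (h \<otimes> inv g) \<otimes> y \<otimes> inv (h \<otimes> inv g)" if "h \<in> carrier G" for h
  proof -
    have "(h \<otimes> inv g) \<otimes> y \<otimes> inv (h \<otimes> inv g)
        = (h \<otimes> inv g \<otimes> g) \<otimes> x \<otimes> inv (h \<otimes> inv g \<otimes> g)"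
      using that g by (intro a) auto
    also have "h \<otimes> inv g \<otimes> g = h"
      using that g by (simp add: m_assoc)
    finally show ?thesis by simp
  qed
  show ?thesis
  proof (intro equalityI subsetI)
    fix z assume "z \<in> conjugacy_class G y"
    then obtain h where "h \<in> carrier G" "z = h \<otimes> y \<otimes> inv h"
      unfolding conjugacy_class_def by blast
    then show "z \<in> conjugacy_class G x"
      using a g unfolding conjugacy_class_def by blast
  next
    fix z assume "z \<in> conjugacy_class G x"
    then obtain h where "h \<in> carrier G" "z = h \<otimes> x \<otimes> inv h"
      unfolding conjugacy_class_def by blast
    then show "z \<in> conjugacy_class G y"
      using b g unfolding conjugacy_class_def by blast
  qed
qed

lemma conjugacy_growth_eq_twisted_growth_id:
  "conjugacy_growth G S n = twisted_growth G S id n"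
proof -
  have sub: "word_ball G S n \<subseteq> carrier G"
    unfolding word_ball_def by blast
  have "{C \<in> conjugacy_class G ` carrier G. C \<inter> word_ball G S n \<noteq> {}}
      = conjugacy_class G ` word_ball G S n"
    using sub conjugacy_class_self conjugacy_class_eq by blast
  also have "\<dots> = twisted_class G id ` word_ball G S n"
    using sub twisted_class_id by (intro image_cong) auto
  finally show ?thesis
    unfolding conjugacy_growth_def twisted_growth_def by simp
qed

lemma foldr_mult_closed:
  "set ws \<subseteq> carrier G \<Longrightarrow> foldr (\<otimes>) ws \<one> \<in> carrier G"
  by (induction ws) auto

lemma foldr_mult_append:
  assumes "set us \<subseteq> carrier G" "set vs \<subseteq> carrier G"
  shows "foldr (\<otimes>) (us @ vs) \<one> = foldr (\<otimes>) us \<one> \<otimes> foldr (\<otimes>) vs \<one>"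
  using assms by (induction us) (auto simp: m_assoc foldr_mult_closed)

lemma generate_imp_word:
  assumes S: "S \<subseteq> carrier G" and g: "g \<in> generate G S"
  shows "\<exists>ws. set ws \<subseteq> S \<union> m_inv G ` S \<and> foldr (\<otimes>) ws \<one> = g"
  using g
proof (induction rule: generate.induct)
  case one
  show ?case by (rule exI[of _ "[]"]) simp
next
  case (incl h)
  then show ?case using S by (intro exI[of _ "[h]"]) auto
next
  case (inv h)
  then show ?case using S by (intro exI[of _ "[inv h]"]) auto
next
  case (eng g h)
  then obtain us vs where "set us \<subseteq> S \<union> m_inv G ` S" "foldr (\<otimes>) us \<one> = g"
    "set vs \<subseteq> S \<union> m_inv G ` S" "foldr (\<otimes>) vs \<one> = h" by blast
  moreover have "S \<union> m_inv G ` S \<subseteq> carrier G" using S by auto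
  ultimately show ?case
    using foldr_mult_append[of us vs] by (intro exI[of _ "us @ vs"]) auto
qed

text \<open>Balls are finite, so the cardinalities above do count classes.\<close>

lemma finite_word_ball:
  assumes "finite_generating_set G S"
  shows "finite (word_ball G S n)"
proof -
  let ?A = "S \<union> m_inv G ` S"
  have "word_ball G S n \<subseteq> (\<lambda>ws. foldr (\<otimes>) ws \<one>) ` {ws. set ws \<subseteq> ?A \<and> length ws \<le> n}"
  proof
    fix g assume g: "g \<in> word_ball G S n"
    then have "g \<in> generate G S"
      using assms unfolding word_ball_def finite_generating_set_def by simp
    then have "\<exists>k ws. set ws \<subseteq> ?A \<and> length ws = k \<and> foldr (\<otimes>) ws \<one> = g"
      using generate_imp_word assms unfolding finite_generating_set_def by blast
    from LeastI_ex[OF this] obtain ws where "set ws \<subseteq> ?A" "length ws = word_norm G S g"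
      "foldr (\<otimes>) ws \<one> = g"
      unfolding word_norm_def by blast
    then show "g \<in> (\<lambda>ws. foldr (\<otimes>) ws \<one>) ` {ws. set ws \<subseteq> ?A \<and> length ws \<le> n}"
      using g unfolding word_ball_def by (intro image_eqI[of _ _ ws]) auto
  qed
  moreover have "finite {ws. set ws \<subseteq> ?A \<and> length ws \<le> n}"
    using assms unfolding finite_generating_set_def by (intro finite_lists_length_le) simp
  ultimately show ?thesis
    by (meson finite_imageI finite_subset)
qed

end

end

theory Submission
  imports Defs
begin

text \<open>Let \<open>c\<close> generate \<open>[G, G]\<close>, let \<open>Q = G / [G, G]\<close> with projection \<open>\<pi>\<close>, and write
  \<open>x y = c\<^bsup>\<omega> x y\<^esup> y x\<close> with \<open>\<omega>\<close> biadditive. Conjugacy classes lie in fibres of \<open>\<pi>\<close>, so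
  the size of a ball in \<open>Q\<close> bounds the conjugacy growth from below. This lower bound suffices except
  when \<open>1 - \<psi>\<close> has finite exponent on \<open>Q\<close>, where twisted classes are sent to conjugacy classes.

  If \<open>f\<close> is fixed by \<open>\<psi>\<close> modulo \<open>[G, G]\<close>, i.e. \<open>f \<psi>(f)\<^sup>-\<^sup>1 = c\<^bsup>\<mu> f\<^esup>\<close>, then twisted conjugation by
  \<open>f\<close> multiplies \<open>x\<close> by \<open>c\<^bsup>\<omega> f x + \<mu> f\<^esup>\<close>. If \<open>\<mu> f \<noteq> 0\<close> for some central such \<open>f\<close>, each fibre of
  \<open>\<pi>\<close> meets at most \<open>\<bar>\<mu> f\<bar>\<close> classes. Otherwise \<open>\<psi>\<close> fixes \<open>c\<close>, and there are three cases. When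
  \<open>1 - \<psi>\<close> has finite exponent on \<open>Q\<close>, linear algebra gives \<open>N \<mu> f = \<omega> f y\<close>, so that
  \<open>c\<^sup>j x \<mapsto> c\<^sup>j x\<^sup>N y\<close> sends twisted classes to conjugacy classes with bounded fibres. When
  \<open>f\<close> as above is not central, the points with \<open>\<omega> f x + \<mu> f \<noteq> 0\<close> carry linearly many classes per
  orbit of translation by an infinite order element of \<open>(1 - \<psi>) Q\<close>, and the others, lying on a
  hyperplane, carry quadratically many; packing disjoint translates in one, respectively two,
  directions into a ball of \<open>Q\<close> absorbs these factors. When all such \<open>f\<close> are central,
  \<open>(1 - \<psi>) Q\<close> contains two independent directions, which absorb the quadratic factor. The
  quadratic bound is the distortion of \<open>\<langle>c\<rangle>\<close> in \<open>G\<close>.\<close>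

subsection \<open>Counting and linear algebra over the integers\<close>

text \<open>Summation over the values of \<open>h\<close>. The upper bounds for numbers of twisted
  classes below arise in this way, with \<open>h\<close> recording a fibre of \<pi>, an orbit or a
  conjugacy class.\<close>

lemma card_image_le_fibres:
  assumes "finite X"
    and "\<And>x. x \<in> X \<Longrightarrow> card (f ` {y \<in> X. h y = h x}) \<le> K"
  shows "card (f ` X) \<le> K * card (h ` X)"
proof -
  have "f ` X = (\<Union>v\<in>h ` X. f ` {y \<in> X. h y = v})" by auto
  then have "card (f ` X) \<le> (\<Sum>v\<in>h ` X. card (f ` {y \<in> X. h y = v}))"
    using card_UN_le[of "h ` X" "\<lambda>v. f ` {y \<in> X. h y = v}"] assms(1) by simp
  also have "\<dots> \<le> (\<Sum>v\<in>h ` X. K)"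
    using assms(2) by (intro sum_mono) auto
  finally show ?thesis by (simp add: mult.commute)
qed

text \<open>One representative is chosen for each value of \<open>h\<close>. Its translates
  \<open>\<theta> x j\<close> are then pairwise different, within one value by \<open>inj\<close>
  and across values by \<open>cl\<close>. This is the abstract form of packing disjoint translates
  into a ball.\<close>

lemma card_image_mult_le:
  assumes "finite Y" and "\<And>x j. x \<in> X \<Longrightarrow> j \<in> J \<Longrightarrow> \<theta> x j \<in> Y"
    and cl: "\<And>x x' j j'. \<lbrakk>x \<in> X; x' \<in> X; j \<in> J; j' \<in> J; \<theta> x j = \<theta> x' j'\<rbrakk> \<Longrightarrow> h x = h x'"
    and inj: "\<And>x j j'. \<lbrakk>x \<in> X; j \<in> J; j' \<in> J; \<theta> x j = \<theta> x j'\<rbrakk> \<Longrightarrow> j = j'"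
  shows "card (h ` X) * card J \<le> card Y"
proof -
  define r where "r = inv_into X h"
  have r: "r v \<in> X" "h (r v) = v" if "v \<in> h ` X" for v
    using that by (auto simp: r_def inv_into_into f_inv_into_f)
  have "inj_on (\<lambda>(v, j). \<theta> (r v) j) (h ` X \<times> J)"
  proof (intro inj_onI, clarify)
    fix x j x' j'
    assume a: "x \<in> X" "j \<in> J" "x' \<in> X" "j' \<in> J" "\<theta> (r (h x)) j = \<theta> (r (h x')) j'"
    then have "h x = h x'" using cl[of "r (h x)" "r (h x')" j j'] r by simp
    then show "h x = h x' \<and> j = j'" using a inj[of "r (h x)" j j'] r by auto
  qed
  moreover have "(\<lambda>(v, j). \<theta> (r v) j) ` (h ` X \<times> J) \<subseteq> Y"
    using r assms(2) by auto
  ultimately have "card (h ` X \<times> J) \<le> card Y"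
    using assms(1) card_inj_on_le by blast
  then show ?thesis by (simp add: card_cartesian_product)
qed

text \<open>Division with remainder by the least positive element; \<open>d = 0\<close> occurs for
  the trivial subgroup. Its later use is for the exponents by which conjugation can shift one given
  element.\<close>

lemma int_subgroup_principal:
  fixes W :: "int set"
  assumes "0 \<in> W" and "\<And>x y. x \<in> W \<Longrightarrow> y \<in> W \<Longrightarrow> x - y \<in> W"
  obtains d where "d \<in> W" and "\<And>x. x \<in> W \<Longrightarrow> d dvd x"
proof (cases "\<exists>x\<in>W. x \<noteq> 0")
  case False
  then show ?thesis using that[of 0] assms(1) by auto
next
  case True
  have neg: "- x \<in> W" if "x \<in> W" for x using assms(2)[of 0 x] assms(1) that by simp
  define n where "n = (LEAST n. 0 < n \<and> int n \<in> W)"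
  obtain x where "x \<in> W" "x \<noteq> 0" using True by auto
  then have "int (nat \<bar>x\<bar>) \<in> W" "0 < nat \<bar>x\<bar>" using neg by (auto simp: abs_if)
  then have ex: "\<exists>n. 0 < n \<and> int n \<in> W" by blast
  have n: "0 < n" "int n \<in> W" using LeastI_ex[OF ex] by (auto simp: n_def)
  have add: "x + y \<in> W" if "x \<in> W" "y \<in> W" for x y
    using assms(2)[of x "- y"] neg that by simp
  have multn: "int k * int n \<in> W" for k
    by (induction k) (use assms(1) add n in \<open>auto simp: algebra_simps\<close>)
  have mult: "k * int n \<in> W" for k
    using multn[of "nat k"] neg[OF multn[of "nat (- k)"]] by (cases "k \<ge> 0") auto
  show ?thesis
  proof (rule that)
    show "int n \<in> W" by fact
    fix x assume "x \<in> W"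
    then have w: "x mod int n \<in> W"
      using assms(2)[OF _ mult[of "x div int n"], of x] by (simp add: minus_div_mult_eq_mod)
    show "int n dvd x"
    proof (rule ccontr)
      assume "\<not> int n dvd x"
      then have "0 < x mod int n" using n pos_mod_sign[of "int n" x] by (metis dvd_eq_mod_eq_0 of_nat_0_less_iff order_le_less)
      moreover have "x mod int n < int n" using n by simp
      moreover have "n \<le> nat (x mod int n)"
        using Least_le[of "\<lambda>n. 0 < n \<and> int n \<in> W" "nat (x mod int n)"] w calculation
        by (simp flip: n_def)
      ultimately show False by linarith
    qed
  qed
qed

text \<open>A recursive form of \<open>word_ball\<close>, suited to induction on the radius. It is
  meaningful also for sets that do not generate the group, which matters when generators are added
  one at a time.\<close>

primrec product_ball :: "('a, 'b) monoid_scheme \<Rightarrow> 'a set \<Rightarrow> nat \<Rightarrow> 'a set" where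
  "product_ball G S 0 = {\<one>\<^bsub>G\<^esub>}"
| "product_ball G S (Suc n) = product_ball G S n
     \<union> {a \<otimes>\<^bsub>G\<^esub> g | a g. a \<in> S \<union> m_inv G ` S \<and> g \<in> product_ball G S n}"

text \<open>Additivity is asked on a subset \<open>H\<close> because \<mu> below carries meaning on
  the subgroup \<open>Fix\<close> only.\<close>

definition additive_on :: "('a, 'b) monoid_scheme \<Rightarrow> 'a set \<Rightarrow> ('a \<Rightarrow> int) \<Rightarrow> bool" where
  "additive_on G H f \<longleftrightarrow> (\<forall>x\<in>H. \<forall>y\<in>H. f (x \<otimes>\<^bsub>G\<^esub> y) = f x + f y)"

section \<open>Balls in the word metric\<close>

context group
begin

lemma product_ball_mono: "m \<le> n \<Longrightarrow> product_ball G S m \<subseteq> product_ball G S n"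
  by (rule lift_Suc_mono_le[of "product_ball G S"]) auto

lemma product_ball_closed: "S \<subseteq> carrier G \<Longrightarrow> product_ball G S n \<subseteq> carrier G"
  by (induction n) auto

lemma product_ball_mono_set: "S \<subseteq> T \<Longrightarrow> product_ball G S n \<subseteq> product_ball G T n"
  by (induction n) (auto, blast+)

lemma finite_product_ball: "finite S \<Longrightarrow> finite (product_ball G S n)"
proof (induction n)
  case (Suc n)
  have "{a \<otimes> g | a g. a \<in> S \<union> m_inv G ` S \<and> g \<in> product_ball G S n}
      = (\<lambda>(a, g). a \<otimes> g) ` ((S \<union> m_inv G ` S) \<times> product_ball G S n)" by auto
  then show ?case using Suc by simp
qed simp

lemma one_in_product_ball: "\<one> \<in> product_ball G S n"
  by (induction n) auto

lemma gen_in_product_ball: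
  assumes "S \<subseteq> carrier G" "s \<in> S" shows "s \<in> product_ball G S 1"
proof -
  have "s = s \<otimes> \<one>" using assms by auto
  then show ?thesis using assms(2) by (auto intro!: exI[of _ s])
qed

lemma product_ball_mult:
  assumes S: "S \<subseteq> carrier G" and "x \<in> product_ball G S m" "y \<in> product_ball G S n"
  shows "x \<otimes> y \<in> product_ball G S (m + n)"
  using assms(2)
proof (induction m arbitrary: x)
  case 0
  then have "y \<in> carrier G" using assms(3) product_ball_closed[OF S] by blast
  then show ?case using 0 assms(3) by simp
next
  case (Suc m)
  show ?case
  proof (cases "x \<in> product_ball G S m")
    case True
    then show ?thesis using Suc.IH by simp
  next
    case False
    then obtain a g where ag: "x = a \<otimes> g" "a \<in> S \<union> m_inv G ` S" "g \<in> product_ball G S m"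
      using Suc.prems by auto
    have "a \<in> carrier G" "g \<in> carrier G" "y \<in> carrier G"
      using ag S assms(3) product_ball_closed[OF S] by auto
    then have "x \<otimes> y = a \<otimes> (g \<otimes> y)" using ag(1) by (simp add: m_assoc)
    then show ?thesis using ag(2) Suc.IH[OF ag(3)] by auto
  qed
qed

lemma product_ball_inv:
  assumes S: "S \<subseteq> carrier G" and "x \<in> product_ball G S n"
  shows "inv x \<in> product_ball G S n"
  using assms(2)
proof (induction n arbitrary: x)
  case (Suc n)
  show ?case
  proof (cases "x \<in> product_ball G S n")
    case True
    then show ?thesis using Suc.IH by simp
  next
    case False
    then obtain a g where ag: "x = a \<otimes> g" "a \<in> S \<union> m_inv G ` S" "g \<in> product_ball G S n"
      using Suc.prems by auto
    have c: "a \<in> carrier G" "g \<in> carrier G" using ag S product_ball_closed[OF S] by auto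
    have "inv a \<in> S \<union> m_inv G ` S" using ag(2) S by auto
    then have "inv a \<otimes> \<one> \<in> product_ball G S 1" by auto
    then have "inv a \<in> product_ball G S 1" using c by simp
    then have "inv g \<otimes> inv a \<in> product_ball G S (n + 1)"
      using product_ball_mult[OF S] Suc.IH[OF ag(3)] by blast
    then show ?thesis using ag c by (simp add: inv_mult_group)
  qed
qed simp

lemma product_ball_int_pow:
  assumes S: "S \<subseteq> carrier G" and x: "x \<in> product_ball G S n"
  shows "x [^] (k::int) \<in> product_ball G S (nat \<bar>k\<bar> * n)"
proof -
  have c: "x \<in> carrier G" using x product_ball_closed[OF S] by auto
  have nat: "x [^] (j::nat) \<in> product_ball G S (j * n)" for j
  proof (induction j)
    case (Suc j)
    then show ?case using product_ball_mult[OF S Suc x] by (simp add: add.commute)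
  qed simp
  show ?thesis
  proof (cases k rule: int_cases2)
    case (nonneg j)
    then show ?thesis using nat[of j] by (simp add: int_pow_int)
  next
    case (nonpos j)
    then show ?thesis using product_ball_inv[OF S nat[of j]] c by (simp add: int_pow_neg_int)
  qed
qed

lemma generate_subset_product_balls:
  assumes S: "S \<subseteq> carrier G" and g: "g \<in> generate G S"
  shows "\<exists>n. g \<in> product_ball G S n"
  using g
proof (induction rule: generate.induct)
  case one
  show ?case using one_in_product_ball by blast
next
  case (incl h)
  then show ?case using gen_in_product_ball[OF S] by blast
next
  case (inv h)
  then show ?case using product_ball_inv[OF S gen_in_product_ball[OF S]] by blast
next
  case (eng h1 h2)
  then show ?case using product_ball_mult[OF S] by blast
qed

text \<open>Every letter from \<open>S\<close> is replaced by a word of length at most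
  \<open>k\<close> in \<open>T\<close>. A change of generating set thus only rescales the
  radius.\<close>

lemma product_ball_scale:
  assumes T: "T \<subseteq> carrier G" and ST: "S \<subseteq> product_ball G T k"
  shows "product_ball G S n \<subseteq> product_ball G T (k * n)"
proof (induction n)
  case (Suc n)
  have "a \<otimes> g \<in> product_ball G T (k * Suc n)"
    if "a \<in> S \<union> m_inv G ` S" "g \<in> product_ball G S n" for a g
  proof -
    have "a \<in> product_ball G T k" using that(1) ST product_ball_inv[OF T] by auto
    then show ?thesis using product_ball_mult[OF T, of a k g "k * n"] that(2) Suc by auto
  qed
  moreover have "product_ball G S n \<subseteq> product_ball G T (k * Suc n)"
    using Suc product_ball_mono[of "k * n" "k * Suc n" T] by (auto simp del: mult_Suc_right)
  ultimately show ?case by auto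
qed simp

lemma finite_subset_product_ball:
  assumes S: "finite_generating_set G S" and F: "finite F" "F \<subseteq> carrier G"
  shows "\<exists>k. F \<subseteq> product_ball G S k"
  using F
proof (induction F rule: finite_induct)
  case (insert x F)
  then obtain k where "F \<subseteq> product_ball G S k" by auto
  moreover obtain l where "x \<in> product_ball G S l"
    using generate_subset_product_balls[of S x] insert S
    unfolding finite_generating_set_def by auto
  moreover have "product_ball G S k \<subseteq> product_ball G S (max k l)"
    "product_ball G S l \<subseteq> product_ball G S (max k l)"
    by (simp_all add: product_ball_mono)
  ultimately have "insert x F \<subseteq> product_ball G S (max k l)" by blast
  then show ?case by blast
qed simp

lemma word_in_product_ball:
  assumes "set ws \<subseteq> S \<union> m_inv G ` S"
  shows "foldr (\<otimes>) ws \<one> \<in> product_ball G S (length ws)"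
  using assms by (induction ws) auto

lemma product_ball_word:
  assumes "g \<in> product_ball G S n"
  shows "\<exists>ws. set ws \<subseteq> S \<union> m_inv G ` S \<and> length ws \<le> n \<and> foldr (\<otimes>) ws \<one> = g"
  using assms
proof (induction n arbitrary: g)
  case (Suc n)
  show ?case
  proof (cases "g \<in> product_ball G S n")
    case True
    then show ?thesis using Suc.IH[of g] le_SucI by blast
  next
    case False
    then obtain a h where ah: "g = a \<otimes> h" "a \<in> S \<union> m_inv G ` S" "h \<in> product_ball G S n"
      using Suc.prems by auto
    obtain ws where "set ws \<subseteq> S \<union> m_inv G ` S" "length ws \<le> n" "foldr (\<otimes>) ws \<one> = h"
      using Suc.IH[OF ah(3)] by blast
    then show ?thesis using ah by (intro exI[of _ "a # ws"]) auto
  qed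
qed auto

lemma word_ball_eq_product_ball:
  assumes "finite_generating_set G S"
  shows "word_ball G S n = product_ball G S n"
proof -
  have S: "S \<subseteq> carrier G" and gen: "generate G S = carrier G"
    using assms by (auto simp: finite_generating_set_def)
  show ?thesis
  proof (intro equalityI subsetI)
    fix g assume g: "g \<in> word_ball G S n"
    then have "g \<in> generate G S" using gen by (simp add: word_ball_def)
    then have "\<exists>k ws. set ws \<subseteq> S \<union> m_inv G ` S \<and> length ws = k \<and> foldr (\<otimes>) ws \<one> = g"
      using generate_imp_word[OF S] by blast
    from LeastI_ex[OF this] obtain ws where "set ws \<subseteq> S \<union> m_inv G ` S"
      "length ws = word_norm G S g" "foldr (\<otimes>) ws \<one> = g"
      unfolding word_norm_def by blast
    then show "g \<in> product_ball G S n"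
      using word_in_product_ball[of ws S] g product_ball_mono[of "word_norm G S g" n S]
      by (auto simp: word_ball_def)
  next
    fix g assume g: "g \<in> product_ball G S n"
    then obtain ws where ws: "set ws \<subseteq> S \<union> m_inv G ` S" "length ws \<le> n"
      "foldr (\<otimes>) ws \<one> = g" using product_ball_word by blast
    have "word_norm G S g \<le> length ws"
      unfolding word_norm_def by (rule Least_le) (use ws in blast)
    then show "g \<in> word_ball G S n"
      using ws(2) g product_ball_closed[OF S] by (auto simp: word_ball_def)
  qed
qed

section \<open>Additive functions with integer values\<close>

lemma additive_on_int_pow:
  assumes H: "subgroup H G" and f: "additive_on G H f" and x: "x \<in> H"
  shows "f (x [^] (k::int)) = k * f x"
proof -
  have xc: "x \<in> carrier G" using subgroup.mem_carrier[OF H] x by blast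
  have pH: "x [^] (k::int) \<in> H" for k using H x subgroup_int_pow_closed by blast
  have add: "f (y \<otimes> z) = f y + f z" if "y \<in> H" "z \<in> H" for y z
    using f that by (auto simp: additive_on_def)
  have one: "f \<one> = 0" using add[of \<one> \<one>] subgroup.one_closed[OF H] by simp
  have step: "f (x [^] (k + 1)) = f (x [^] k) + f x" for k :: int
    using add[OF pH x] xc by (simp add: int_pow_mult)
  show ?thesis
  proof (induction k rule: int_induct[where k = 0])
    case base
    then show ?case using one by simp
  next
    case (step1 i)
    then show ?case using step[of i] by (simp add: algebra_simps)
  next
    case (step2 i)
    then show ?case using step[of "i - 1"] by (simp add: algebra_simps)
  qed
qed

text \<open>Over the rationals, a linear form vanishing on the common kernel of finitely many forms
  is a combination of them; \<open>N\<close> clears the denominators. The induction passes to the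
  kernel \<open>H'\<close> of one form, and the defect \<nu> of the relation found on
  \<open>H'\<close> must then be a rational multiple of that form.\<close>

lemma additive_on_dependent:
  assumes "finite I" "subgroup H G"
    and "\<And>i. i \<in> I \<Longrightarrow> additive_on G H (\<phi> i)" and "additive_on G H \<mu>"
    and "\<And>h. h \<in> H \<Longrightarrow> (\<And>i. i \<in> I \<Longrightarrow> \<phi> i h = 0) \<Longrightarrow> \<mu> h = 0"
  shows "\<exists>N n. N \<noteq> 0 \<and> (\<forall>h\<in>H. N * \<mu> h = (\<Sum>i\<in>I. n i * \<phi> i h))"
  using assms
proof (induction I arbitrary: H rule: finite_induct)
  case empty
  then show ?case by (intro exI[of _ 1]) auto
next
  case (insert i I)
  note H = insert.prems(1)
  note pow = additive_on_int_pow[OF H]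
  have Hc: "x \<in> carrier G" if "x \<in> H" for x using subgroup.mem_carrier[OF H that] .
  have \<phi>: "additive_on G H (\<phi> j)" if "j \<in> insert i I" for j using insert.prems(2) that by auto
  define H' where "H' = {h \<in> H. \<phi> i h = 0}"
  have H': "subgroup H' G"
  proof (rule subgroupI)
    show "H' \<subseteq> carrier G" using Hc by (auto simp: H'_def)
    have "\<one> \<in> H'" using subgroup.one_closed[OF H] pow[OF \<phi>, of i \<one> 0] by (simp add: H'_def)
    then show "H' \<noteq> {}" by blast
    show "inv a \<in> H'" if "a \<in> H'" for a
      using that subgroup.m_inv_closed[OF H] pow[OF \<phi>, of i a "- 1"] Hc
      by (auto simp: H'_def int_pow_neg)
    show "a \<otimes> b \<in> H'" if "a \<in> H'" "b \<in> H'" for a b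
      using that subgroup.m_closed[OF H] \<phi>[of i] by (auto simp: H'_def additive_on_def)
  qed
  have "\<exists>N n. N \<noteq> 0 \<and> (\<forall>h\<in>H'. N * \<mu> h = (\<Sum>j\<in>I. n j * \<phi> j h))"
  proof (rule insert.IH[OF H'])
    show "additive_on G H' (\<phi> j)" if "j \<in> I" for j
      using \<phi>[of j] that by (auto simp: additive_on_def H'_def)
    show "additive_on G H' \<mu>"
      using insert.prems(3) by (auto simp: additive_on_def H'_def)
    show "\<mu> h = 0" if "h \<in> H'" "\<And>j. j \<in> I \<Longrightarrow> \<phi> j h = 0" for h
      using insert.prems(4)[of h] that by (auto simp: H'_def)
  qed
  then obtain N n where N: "N \<noteq> 0" and eq: "\<And>h. h \<in> H' \<Longrightarrow> N * \<mu> h = (\<Sum>j\<in>I. n j * \<phi> j h)"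
    by blast
  define \<nu> where "\<nu> h = N * \<mu> h - (\<Sum>j\<in>I. n j * \<phi> j h)" for h
  have \<nu>: "additive_on G H \<nu>"
    unfolding additive_on_def
  proof (intro ballI)
    fix x y assume xy: "x \<in> H" "y \<in> H"
    have "(\<Sum>j\<in>I. n j * \<phi> j (x \<otimes> y)) = (\<Sum>j\<in>I. n j * \<phi> j x + n j * \<phi> j y)"
      using \<phi> xy by (intro sum.cong) (auto simp: additive_on_def algebra_simps)
    moreover have "\<mu> (x \<otimes> y) = \<mu> x + \<mu> y" using insert.prems(3) xy by (auto simp: additive_on_def)
    ultimately show "\<nu> (x \<otimes> y) = \<nu> x + \<nu> y"
      by (simp add: \<nu>_def sum.distrib algebra_simps)
  qed
  show ?case
  proof (cases "\<exists>a\<in>H. \<phi> i a \<noteq> 0")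
    case False
    then have "H' = H" by (auto simp: H'_def)
    \<comment> \<open>Here \<open>\<phi> i\<close> vanishes on all of \<open>H\<close>, so the
      relation from \<open>H'\<close> persists and \<open>i\<close> may receive the coefficient
      0.\<close>
    then have "\<forall>h\<in>H. N * \<mu> h = (\<Sum>j\<in>insert i I. (n(i := 0)) j * \<phi> j h)"
      using eq insert.hyps by (auto intro!: sum.cong)
    then show ?thesis using N by blast
  next
    case True
    then obtain a where a: "a \<in> H" "\<phi> i a \<noteq> 0" by blast
    define t where "t = \<phi> i a"
    \<comment> \<open>The element \<open>h [^] t \<otimes> a [^] (- \<phi> i h)\<close> is built so
      that \<open>\<phi> i\<close> vanishes on it; evaluating \<nu> there gives the
      proportionality.\<close>
    have "t * \<nu> h = \<phi> i h * \<nu> a" if h: "h \<in> H" for h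
    proof -
      have in1: "h [^] t \<in> H" "a [^] (- \<phi> i h) \<in> H"
        using h a H subgroup_int_pow_closed by blast+
      have add: "f (h [^] t \<otimes> a [^] (- \<phi> i h)) = t * f h - \<phi> i h * f a" if "additive_on G H f" for f
        using that in1 pow[OF that h, of t] pow[OF that a(1), of "- \<phi> i h"]
        by (auto simp: additive_on_def)
      have "h [^] t \<otimes> a [^] (- \<phi> i h) \<in> H'"
        using add[OF \<phi>[of i]] subgroup.m_closed[OF H in1] by (auto simp: H'_def t_def)
      then have "\<nu> (h [^] t \<otimes> a [^] (- \<phi> i h)) = 0" using eq by (auto simp: \<nu>_def)
      then show ?thesis using add[OF \<nu>] by simp
    qed
    then have "\<forall>h\<in>H. t * N * \<mu> h = (\<Sum>j\<in>insert i I. ((\<lambda>j. t * n j)(i := \<nu> a)) j * \<phi> j h)"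
    proof (intro ballI)
      fix h assume a1: "\<And>h. h \<in> H \<Longrightarrow> t * \<nu> h = \<phi> i h * \<nu> a" and h: "h \<in> H"
      have "(\<Sum>j\<in>insert i I. ((\<lambda>j. t * n j)(i := \<nu> a)) j * \<phi> j h)
          = \<nu> a * \<phi> i h + (\<Sum>j\<in>I. t * n j * \<phi> j h)"
        using insert.hyps by (auto intro!: sum.cong)
      also have "\<dots> = t * \<nu> h + t * (\<Sum>j\<in>I. n j * \<phi> j h)"
        using a1[OF h] by (simp add: sum_distrib_left mult.assoc)
      also have "\<dots> = t * N * \<mu> h" by (simp add: \<nu>_def algebra_simps)
      finally show "t * N * \<mu> h = (\<Sum>j\<in>insert i I. ((\<lambda>j. t * n j)(i := \<nu> a)) j * \<phi> j h)" by simp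
    qed
    moreover have "t * N \<noteq> 0" using N a by (simp add: t_def)
    ultimately show ?thesis by blast
  qed
qed

end

subsection \<open>Distortion of central cyclic subgroups\<close>

context group
begin

lemma int_pow_commute:
  assumes "x \<in> carrier G" "y \<in> carrier G" "x \<otimes> y = y \<otimes> x"
  shows "x [^] (k::int) \<otimes> y = y \<otimes> x [^] k"
proof (cases k rule: int_cases2)
  case (nonneg j)
  then show ?thesis using group_commutes_pow[of x y j] assms by (simp add: int_pow_int)
next
  case (nonpos j)
  have "x [^] j \<otimes> y = y \<otimes> x [^] j" using group_commutes_pow[of x y j] assms by simp
  then have "x [^] j \<otimes> (y \<otimes> inv (x [^] j)) = y"
    using assms by (simp add: m_assoc[symmetric]) (simp add: m_assoc)
  then have "y \<otimes> inv (x [^] j) = inv (x [^] j) \<otimes> y"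
    using assms by (simp add: inv_solve_left)
  then show ?thesis using nonpos assms by (simp add: int_pow_neg_int)
qed

lemma group_center_closed: "z \<in> group_center G \<Longrightarrow> z \<in> carrier G"
  by (simp add: group_center_def)

lemma group_center_commute:
  "z \<in> group_center G \<Longrightarrow> x \<in> carrier G \<Longrightarrow> z \<otimes> x = x \<otimes> z"
  by (simp add: group_center_def)

lemma subgroup_group_center: "subgroup (group_center G) G"
proof (rule subgroupI)
  show "group_center G \<subseteq> carrier G" by (auto simp: group_center_def)
  have "\<one> \<in> group_center G" by (simp add: group_center_def)
  then show "group_center G \<noteq> {}" by blast
  show "inv a \<in> group_center G" if a: "a \<in> group_center G" for a
  proof -
    have "inv a \<otimes> g = g \<otimes> inv a" if g: "g \<in> carrier G" for g
      using int_pow_commute[OF _ _ group_center_commute[OF a g], of "- 1"] a g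
      by (simp add: group_center_closed int_pow_neg)
    then show ?thesis using a by (simp add: group_center_def)
  qed
  show "a \<otimes> b \<in> group_center G" if ab: "a \<in> group_center G" "b \<in> group_center G" for a b
  proof -
    have "a \<otimes> b \<otimes> g = g \<otimes> (a \<otimes> b)" if g: "g \<in> carrier G" for g
    proof -
      have "a \<otimes> b \<otimes> g = a \<otimes> g \<otimes> b"
        using ab g group_center_commute[OF ab(2) g] by (simp add: group_center_closed m_assoc)
      also have "\<dots> = g \<otimes> (a \<otimes> b)"
        using ab g group_center_commute[OF ab(1) g] by (simp add: group_center_closed m_assoc)
      finally show ?thesis .
    qed
    then show ?thesis using ab[THEN group_center_closed] by (simp add: group_center_def)
  qed
qed

text \<open>The letters \<open>s\<close> and \<open>inv s\<close> are pushed to the right. Passing a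
  word of length at most \<open>n\<close> costs a power of \<open>b\<close> whose exponent is at
  most \<open>M * n\<close> in absolute value, so the total cost stays below
  \<open>M * n * n\<close>, while the remaining word over \<open>F\<close> does not become
  longer.\<close>

lemma product_ball_insert_decompose:
  assumes T: "insert s F \<subseteq> T" "T \<subseteq> carrier G" and b: "b \<in> group_center G"
    and M: "M \<ge> 0"
    and comm: "\<And>m n x y. \<lbrakk>x \<in> product_ball G T m; y \<in> product_ball G T n\<rbrakk>
      \<Longrightarrow> \<exists>i. \<bar>i\<bar> \<le> M * int m * int n \<and> x \<otimes> y = b [^] (i::int) \<otimes> (y \<otimes> x)"
    and "x \<in> product_ball G (insert s F) n"
  shows "\<exists>w e E. w \<in> product_ball G F n \<and> \<bar>e\<bar> \<le> int n \<and> \<bar>E\<bar> \<le> M * int n * int n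
    \<and> x = w \<otimes> s [^] (e::int) \<otimes> b [^] (E::int)"
  using assms(6)
proof (induction n arbitrary: x)
  case 0
  then show ?case by (intro exI[of _ \<one>] exI[of _ 0]) auto
next
  case (Suc n)
  have F: "F \<subseteq> carrier G" and s: "s \<in> carrier G" and bc: "b \<in> carrier G"
    using T b group_center_closed by auto
  have bound: "M * int n * int n + M * int n \<le> M * int (Suc n) * int (Suc n)"
    using M by (simp add: algebra_simps)
  show ?case
  proof (cases "x \<in> product_ball G (insert s F) n")
    case True
    from Suc.IH[OF this] obtain w e E where w: "w \<in> product_ball G F n" "\<bar>e\<bar> \<le> int n"
      "\<bar>E\<bar> \<le> M * int n * int n" "x = w \<otimes> s [^] (e::int) \<otimes> b [^] (E::int)" by blast
    moreover have "w \<in> product_ball G F (Suc n)" using w(1) by simp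
    moreover have "\<bar>e\<bar> \<le> int (Suc n)" using w(2) by simp
    moreover have "\<bar>E\<bar> \<le> M * int (Suc n) * int (Suc n)" using w(3) bound M
      by (smt (verit) mult_nonneg_nonneg of_nat_0_le_iff)
    ultimately show ?thesis by blast
  next
    case False
    then obtain a g where ag: "x = a \<otimes> g" "a \<in> insert s F \<union> m_inv G ` insert s F"
      "g \<in> product_ball G (insert s F) n" using Suc.prems by auto
    from Suc.IH[OF ag(3)] obtain w e E where w: "w \<in> product_ball G F n" "\<bar>e\<bar> \<le> int n"
      "\<bar>E\<bar> \<le> M * int n * int n" "g = w \<otimes> s [^] (e::int) \<otimes> b [^] (E::int)" by blast
    have wc: "w \<in> carrier G" using w(1) product_ball_closed[OF F] by auto
    have ac: "a \<in> carrier G" using ag(2) F s by auto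
    consider "a \<in> F \<union> m_inv G ` F" | \<eta> :: int where "\<bar>\<eta>\<bar> = 1" "a = s [^] \<eta>"
    proof -
      assume c: "a \<in> F \<union> m_inv G ` F \<Longrightarrow> thesis" "\<And>\<eta>::int. \<bar>\<eta>\<bar> = 1 \<Longrightarrow> a = s [^] \<eta> \<Longrightarrow> thesis"
      consider "a \<in> F \<union> m_inv G ` F" | "a = s" | "a = inv s" using ag(2) by blast
      then show thesis
        using c(1) c(2)[of 1] c(2)[of "- 1"] s by cases (auto simp: int_pow_neg)
    qed
    then show ?thesis
    proof cases
      case 1
      then have "a \<otimes> w \<in> product_ball G F (Suc n)" using w(1) by auto
      moreover have "x = (a \<otimes> w) \<otimes> s [^] e \<otimes> b [^] E"
        using ag(1) w(4) ac wc s bc by (simp add: m_assoc)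
      moreover have "\<bar>e\<bar> \<le> int (Suc n)" using w(2) by simp
      moreover have "\<bar>E\<bar> \<le> M * int (Suc n) * int (Suc n)" using w(3) bound M
        by (smt (verit) mult_nonneg_nonneg of_nat_0_le_iff)
      ultimately show ?thesis by blast
    next
      case 2
      have "s \<in> product_ball G T 1" using gen_in_product_ball[of T s] T by auto
      then have "a \<in> product_ball G T 1"
        using product_ball_int_pow[OF T(2), of s 1 \<eta>] 2 by simp
      moreover have "w \<in> product_ball G T n"
        using w(1) product_ball_mono_set[of F T n] T by auto
      ultimately obtain i where i: "\<bar>i\<bar> \<le> M * int 1 * int n" "a \<otimes> w = b [^] i \<otimes> (w \<otimes> a)"
        using comm by blast
      have bi: "b [^] k \<otimes> y = y \<otimes> b [^] k" if "y \<in> carrier G" for y and k :: int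
        by (rule int_pow_commute[OF bc that group_center_commute[OF b that]])
      have "x = a \<otimes> w \<otimes> (s [^] e \<otimes> b [^] E)"
        using ag(1) w(4) ac wc s bc by (simp add: m_assoc)
      also have "\<dots> = (w \<otimes> a) \<otimes> b [^] i \<otimes> (s [^] e \<otimes> b [^] E)"
        using i(2) bi[of "w \<otimes> a" i] wc ac by simp
      also have "\<dots> = w \<otimes> (a \<otimes> (b [^] i \<otimes> s [^] e) \<otimes> b [^] E)"
        using ac wc s bc by (simp add: m_assoc)
      also have "\<dots> = w \<otimes> ((a \<otimes> s [^] e) \<otimes> (b [^] i \<otimes> b [^] E))"
        using ac wc s bc by (simp add: bi[of "s [^] e" i] m_assoc)
      also have "\<dots> = w \<otimes> s [^] (\<eta> + e) \<otimes> b [^] (i + E)"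
        using 2 s bc wc by (simp add: int_pow_mult m_assoc)
      finally have "x = w \<otimes> s [^] (\<eta> + e) \<otimes> b [^] (i + E)" .
      moreover have "\<bar>\<eta> + e\<bar> \<le> int (Suc n)" using w(2) 2 by linarith
      moreover have "\<bar>i + E\<bar> \<le> M * int (Suc n) * int (Suc n)" using w(3) i(1) bound by simp
      moreover have "w \<in> product_ball G F (Suc n)" using w(1) by simp
      ultimately show ?thesis by blast
    qed
  qed
qed

text \<open>Generators are added one at a time. An element \<open>b [^] k \<otimes> z\<close> of a
  ball over \<open>insert s F\<close> is rewritten as
  \<open>w \<otimes> s [^] e \<otimes> b [^] E\<close> with \<open>w\<close> over \<open>F\<close>.
  Either no nontrivial power of \<open>s\<close> is a product of a word over \<open>F\<close>, a
  power of \<open>b\<close> and an element of \<open>Z\<close>, and then \<open>e = 0\<close>; or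
  such a relation for \<open>s [^] t\<close> eliminates \<open>s\<close> from
  \<open>w [^] t\<close>. In both cases the estimate for \<open>F\<close> applies. The subgroup
  \<open>Z\<close> leaves room for a second central direction, and \<open>M = 0\<close> gives a
  linear bound.\<close>

lemma central_power_distortion:
  assumes T: "finite T" "T \<subseteq> carrier G" and b: "b \<in> group_center G"
    and Z: "subgroup Z G" "Z \<subseteq> group_center G" and inf: "\<And>k::int. b [^] k \<in> Z \<Longrightarrow> k = 0"
    and M: "M \<ge> 0"
    and comm: "\<And>m n x y. \<lbrakk>x \<in> product_ball G T m; y \<in> product_ball G T n\<rbrakk>
      \<Longrightarrow> \<exists>i. \<bar>i\<bar> \<le> M * int m * int n \<and> x \<otimes> y = b [^] (i::int) \<otimes> (y \<otimes> x)"
  shows "\<exists>C\<ge>0. \<forall>n (k::int). \<forall>z\<in>Z. b [^] k \<otimes> z \<in> product_ball G T n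
    \<longrightarrow> \<bar>k\<bar> \<le> C * (int n + M * int n * int n)"
proof -
  have bc: "b \<in> carrier G" using b group_center_closed by auto
  have bi: "b [^] k \<otimes> y = y \<otimes> b [^] k" if "y \<in> carrier G" for y and k :: int
    by (rule int_pow_commute[OF bc that group_center_commute[OF b that]])
  have Zc: "z \<in> carrier G" if "z \<in> Z" for z using that Z group_center_closed by auto
  have Zi: "z [^] k \<otimes> y = y \<otimes> z [^] k" if "z \<in> Z" "y \<in> carrier G" for z y and k :: int
    using int_pow_commute[of z y k] that Z group_center_commute Zc by blast
  note Zpow = subgroup_int_pow_closed[OF Z(1)]
  have "\<exists>C\<ge>0. \<forall>n (k::int). \<forall>z\<in>Z. b [^] k \<otimes> z \<in> product_ball G F n
    \<longrightarrow> \<bar>k\<bar> \<le> C * (int n + M * int n * int n)" if "F \<subseteq> T" for F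
    using finite_subset[OF that T(1)] that
  proof (induction F rule: finite_induct)
    case empty
    \<comment> \<open>Without letters only the identity is available, so \<open>b [^] k\<close> lies
      in \<open>Z\<close> and \<open>k = 0\<close>; hence the constant 0 below.\<close>
    have ball: "product_ball G {} n = {\<one>}" for n by (induction n) auto
    have "k = 0" if "z \<in> Z" "b [^] (k::int) \<otimes> z = \<one>" for k z
    proof -
      have "b [^] k = inv z" using that Zc bc by (simp add: inv_equality)
      then show ?thesis using inf subgroup.m_inv_closed[OF Z(1) that(1)] by simp
    qed
    then have "k = 0" if "z \<in> Z" "b [^] (k::int) \<otimes> z \<in> product_ball G {} n" for k z n
      using that ball by blast
    then have "\<forall>n (k::int). \<forall>z\<in>Z. b [^] k \<otimes> z \<in> product_ball G {} n
      \<longrightarrow> \<bar>k\<bar> \<le> 0 * (int n + M * int n * int n)" by fastforce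
    then show ?case by blast
  next
    case (insert s F)
    have Fc: "F \<subseteq> carrier G" and s: "s \<in> carrier G" using insert.prems T by auto
    have "F \<subseteq> T" using insert.prems by simp
    from insert.IH[OF this] obtain C where C: "C \<ge> 0" and IH: "\<And>n k z. z \<in> Z \<Longrightarrow> b [^] (k::int) \<otimes> z \<in> product_ball G F n
      \<Longrightarrow> \<bar>k\<bar> \<le> C * (int n + M * int n * int n)" by blast
    define \<Phi> where "\<Phi> n = int n + M * int n * int n" for n
    have \<Phi>: "int n \<le> \<Phi> n" "M * int n * int n \<le> \<Phi> n" "0 \<le> \<Phi> n" for n
      using M by (auto simp: \<Phi>_def)
    \<comment> \<open>Enlarging the radius by a factor \<open>q\<close> costs only the constant
      \<open>q * q\<close>, in the linear and in the quadratic term.\<close>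
    have \<Phi>_scale: "\<Phi> (q * n) \<le> int q * int q * \<Phi> n" if "q \<ge> 1" for q n
    proof -
      have "int q * int n \<le> int q * int q * int n"
        using that by (simp add: mult_right_mono)
      then show ?thesis by (simp add: \<Phi>_def algebra_simps)
    qed
    have decomp: "\<exists>w e E. w \<in> product_ball G F n \<and> \<bar>e\<bar> \<le> int n \<and> \<bar>E\<bar> \<le> \<Phi> n
      \<and> w = b [^] (k - E) \<otimes> z \<otimes> s [^] (- e)"
      if z: "z \<in> Z" and x: "b [^] k \<otimes> z \<in> product_ball G (insert s F) n" for k :: int and z n
    proof -
      obtain w e E where w: "w \<in> product_ball G F n" "\<bar>e\<bar> \<le> int n"
        "\<bar>E\<bar> \<le> M * int n * int n" "b [^] k \<otimes> z = w \<otimes> s [^] (e::int) \<otimes> b [^] (E::int)"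
        using product_ball_insert_decompose[OF insert.prems T(2) b M comm x] by blast
      have wc: "w \<in> carrier G" using w(1) product_ball_closed[OF Fc] by auto
      have "b [^] (k - E) \<otimes> z \<otimes> s [^] (- e) = b [^] (- E) \<otimes> (b [^] k \<otimes> z) \<otimes> s [^] (- e)"
        using bc Zc[OF z] s int_pow_mult[OF bc, of "- E" k] by (simp add: m_assoc)
      also have "\<dots> = (w \<otimes> s [^] e \<otimes> b [^] E) \<otimes> b [^] (- E) \<otimes> s [^] (- e)"
        using w(4) bi[of "w \<otimes> s [^] e \<otimes> b [^] E" "- E"] wc s bc by simp
      also have "\<dots> = w"
        using wc s bc by (simp add: m_assoc int_pow_neg)
      finally have "w = b [^] (k - E) \<otimes> z \<otimes> s [^] (- e)" by simp
      moreover have "\<bar>E\<bar> \<le> \<Phi> n" using w(3) \<Phi>(2)[of n] by linarith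
      ultimately show ?thesis using w(1,2) by blast
    qed
    show ?case
    proof (cases "\<exists>t L u a y. (t::int) \<noteq> 0 \<and> u \<in> product_ball G F L \<and> y \<in> Z
        \<and> s [^] t = u \<otimes> (b [^] (a::int) \<otimes> y)")
      case False
      have "\<bar>k\<bar> \<le> (C + 1) * \<Phi> n"
        if z: "z \<in> Z" and x: "b [^] k \<otimes> z \<in> product_ball G (insert s F) n" for k :: int and z n
      proof -
        obtain w e E where w: "w \<in> product_ball G F n" "\<bar>e\<bar> \<le> int n" "\<bar>E\<bar> \<le> \<Phi> n"
          "w = b [^] (k - E) \<otimes> z \<otimes> s [^] (- e)" using decomp[OF z x] by blast
        have wc: "w \<in> carrier G" using w(1) product_ball_closed[OF Fc] by auto
        have "s [^] (- e) = inv (b [^] (k - E) \<otimes> z) \<otimes> w"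
          using w(4) bc Zc[OF z] s by (simp add: inv_solve_left m_assoc)
        also have "\<dots> = w \<otimes> (b [^] (E - k) \<otimes> inv z)"
        proof -
          have zi: "inv z \<in> Z" using subgroup.m_inv_closed[OF Z(1) z] .
          have "inv (b [^] (k - E) \<otimes> z) = inv z \<otimes> b [^] (E - k)"
            using bc Zc[OF z] int_pow_neg[OF bc, of "k - E"] by (simp add: inv_mult_group)
          also have "\<dots> = b [^] (E - k) \<otimes> inv z" using bi[of "inv z"] Zc[OF zi] by simp
          also have "\<dots> \<otimes> w = b [^] (E - k) \<otimes> (w \<otimes> inv z)"
            using Zi[OF zi wc, of 1] Zc[OF zi] wc bc by (simp add: m_assoc)
          also have "\<dots> = w \<otimes> (b [^] (E - k) \<otimes> inv z)"
            using bi[of w "E - k"] Zc[OF zi] wc bc by (simp flip: m_assoc)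
          finally show ?thesis .
        qed
        \<comment> \<open>A nonzero \<open>e\<close> would exhibit a power of \<open>s\<close> of
          the kind excluded in this case.\<close>
        finally have "e = 0"
          using False w(1) subgroup.m_inv_closed[OF Z(1) z]
          by (metis neg_equal_0_iff_equal)
        then have "b [^] (k - E) \<otimes> z \<in> product_ball G F n"
          using w Zc[OF z] bc by simp
        then have "\<bar>k - E\<bar> \<le> C * \<Phi> n" using IH[OF z] by (simp add: \<Phi>_def)
        then show ?thesis using w(3) by (simp add: algebra_simps)
      qed
      then show ?thesis using C unfolding \<Phi>_def by (intro exI[of _ "C + 1"]) auto
    next
      case True
      then obtain t L u a y where t: "(t::int) \<noteq> 0" and u: "u \<in> product_ball G F L"
        and y: "y \<in> Z" and st: "s [^] t = u \<otimes> (b [^] (a::int) \<otimes> y)" by blast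
      have uc: "u \<in> carrier G" using u product_ball_closed[OF Fc] by auto
      \<comment> \<open>The word \<open>w [^] t \<otimes> u [^] e\<close> has length at most
        \<open>\<bar>t\<bar> * n + \<bar>e\<bar> * L\<close> with
        \<open>\<bar>e\<bar> \<le> n\<close>; \<open>q\<close> collects both factors.\<close>
      define q where "q = nat \<bar>t\<bar> + L"
      have q: "q \<ge> 1" using t by (simp add: q_def)
      have "\<bar>k\<bar> \<le> (C * (int q * int q) + \<bar>a\<bar> + \<bar>t\<bar>) * \<Phi> n"
        if z: "z \<in> Z" and x: "b [^] k \<otimes> z \<in> product_ball G (insert s F) n" for k :: int and z n
      proof -
        obtain w e E where w: "w \<in> product_ball G F n" "\<bar>e\<bar> \<le> int n" "\<bar>E\<bar> \<le> \<Phi> n"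
          "w = b [^] (k - E) \<otimes> z \<otimes> s [^] (- e)" using decomp[OF z x] by blast
        have wc: "w \<in> carrier G" using w(1) product_ball_closed[OF Fc] by auto
        have c1: "b [^] (k - E) \<otimes> z \<in> carrier G" using bc Zc[OF z] by simp
        have cent: "(b [^] (j::int) \<otimes> v) \<otimes> g = g \<otimes> (b [^] j \<otimes> v)"
          if "v \<in> Z" "g \<in> carrier G" for j v g
          using that bi[of g j] Zi[OF that, of 1] Zc[OF that(1)] bc by (simp add: m_assoc) (metis bi int_pow_closed m_assoc)
        have cpow: "(b [^] (j::int) \<otimes> v) [^] (l::int) = b [^] (j * l) \<otimes> v [^] l"
          if "v \<in> Z" for j l v
          using bi[of v j] bi[of "v [^] l" "j * l"] Zc[OF that] bc
          by (simp add: int_pow_mult_distrib int_pow_pow)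
        \<comment> \<open>In the \<open>t\<close>-th power, \<open>s\<close> occurs only through
          \<open>s [^] t\<close>, which the relation expresses by \<open>u\<close>, \<open>b\<close>
          and \<open>y\<close>. Multiplication by \<open>u [^] e\<close> then leaves a power of
          \<open>b\<close> times an element of \<open>Z\<close>.\<close>
        have "w [^] t = (b [^] (k - E) \<otimes> z) [^] t \<otimes> (s [^] (- e)) [^] t"
          unfolding w(4) using c1 s cent[OF z, of "s [^] (- e)" "k - E"]
          by (intro int_pow_mult_distrib) auto
        also have "(s [^] (- e)) [^] t = (s [^] t) [^] (- e)"
          using s by (simp add: int_pow_pow mult.commute)
        also have "\<dots> = u [^] (- e) \<otimes> (b [^] (a * (- e)) \<otimes> y [^] (- e))"
          unfolding st using uc bc Zc[OF y] cent[OF y uc, of a]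
          by (subst int_pow_mult_distrib) (auto simp: cpow[OF y])
        finally have wt: "w [^] t = (b [^] ((k - E) * t) \<otimes> z [^] t)
            \<otimes> (u [^] (- e) \<otimes> (b [^] (a * (- e)) \<otimes> y [^] (- e)))"
          by (simp add: cpow[OF z])
        have zt: "z [^] t \<in> Z" "y [^] (- e) \<in> Z" using Zpow z y by auto
        have "w [^] t \<otimes> u [^] e
          = (b [^] ((k - E) * t) \<otimes> z [^] t)
            \<otimes> ((b [^] (a * (- e)) \<otimes> y [^] (- e)) \<otimes> u [^] (- e)) \<otimes> u [^] e"
          unfolding wt using cent[OF zt(2), of "u [^] (- e)"] uc by simp
        also have "\<dots> = (b [^] ((k - E) * t) \<otimes> z [^] t) \<otimes> (b [^] (a * (- e)) \<otimes> y [^] (- e))"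
          using uc bc Zc[OF zt(1)] Zc[OF zt(2)] by (simp add: m_assoc int_pow_neg)
        also have "\<dots> = b [^] ((k - E) * t - a * e) \<otimes> (z [^] t \<otimes> y [^] (- e))"
        proof -
          have "z [^] t \<otimes> (b [^] (a * (- e)) \<otimes> y [^] (- e))
              = b [^] (a * (- e)) \<otimes> (z [^] t \<otimes> y [^] (- e))"
            using bi[of "z [^] t" "a * (- e)"] bc Zc[OF zt(1)] Zc[OF zt(2)]
            by (simp flip: m_assoc)
          then show ?thesis
            using bc Zc[OF zt(1)] Zc[OF zt(2)]
            by (simp add: m_assoc int_pow_diff int_pow_neg)
        qed
        finally have eq: "w [^] t \<otimes> u [^] e
          = b [^] ((k - E) * t - a * e) \<otimes> (z [^] t \<otimes> y [^] (- e))" .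
        have "w [^] t \<otimes> u [^] e \<in> product_ball G F (nat \<bar>t\<bar> * n + nat \<bar>e\<bar> * L)"
          by (intro product_ball_mult[OF Fc] product_ball_int_pow[OF Fc] w u)
        moreover have "nat \<bar>t\<bar> * n + nat \<bar>e\<bar> * L \<le> q * n"
          using w(2) by (simp add: q_def algebra_simps nat_le_iff)
        ultimately have "w [^] t \<otimes> u [^] e \<in> product_ball G F (q * n)"
          using product_ball_mono by blast
        moreover have "z [^] t \<otimes> y [^] (- e) \<in> Z" using subgroup.m_closed[OF Z(1) zt] .
        ultimately have "\<bar>(k - E) * t - a * e\<bar> \<le> C * \<Phi> (q * n)"
          using IH unfolding eq \<Phi>_def by blast
        also have "\<dots> \<le> C * (int q * int q * \<Phi> n)"
          using \<Phi>_scale[OF q] C by (intro mult_left_mono) auto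
        finally have 1: "\<bar>(k - E) * t - a * e\<bar> \<le> C * (int q * int q * \<Phi> n)" .
        have "\<bar>k\<bar> \<le> \<bar>k\<bar> * \<bar>t\<bar>" using t zero_less_abs_iff[of t] by (auto simp: mult_le_cancel_left1)
        also have "\<dots> = \<bar>((k - E) * t - a * e) + a * e + E * t\<bar>"
          by (simp add: algebra_simps flip: abs_mult)
        also have "\<dots> \<le> C * (int q * int q * \<Phi> n) + \<bar>a\<bar> * \<bar>e\<bar> + \<bar>E\<bar> * \<bar>t\<bar>"
          using 1 abs_mult[of a e] abs_mult[of E t] by linarith
        also have "\<dots> \<le> C * (int q * int q * \<Phi> n) + \<bar>a\<bar> * \<Phi> n + \<Phi> n * \<bar>t\<bar>"
          using w(2,3) \<Phi>(1,3)[of n] C by (intro add_mono mult_mono) auto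
        finally show ?thesis by (simp add: algebra_simps)
      qed
      moreover have "C * (int q * int q) + \<bar>a\<bar> + \<bar>t\<bar> \<ge> 0" using C by simp
      ultimately show ?thesis unfolding \<Phi>_def by blast
    qed
  qed
  then show ?thesis by blast
qed

end

section \<open>Finitely generated abelian groups\<close>

context comm_group
begin

lemma group_center_eq_carrier: "group_center G = carrier G"
  by (auto simp: group_center_def m_comm)

text \<open>The previous estimate with \<open>M = 0\<close>, since all commutators vanish, and with
  the powers of \<open>b'\<close> as \<open>Z\<close>. Only the exponent \<open>i\<close> is
  controlled, so \<open>b'\<close> may have finite order or be trivial.\<close>

lemma linear_power_distortion:
  assumes "finite T" "T \<subseteq> carrier G" "b \<in> carrier G" "b' \<in> carrier G"
    and inf: "\<And>(i::int) (j::int). b [^] i \<otimes> b' [^] j = \<one> \<Longrightarrow> i = 0"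
  shows "\<exists>C\<ge>0. \<forall>n (i::int) (j::int). b [^] i \<otimes> b' [^] j \<in> product_ball G T n \<longrightarrow> \<bar>i\<bar> \<le> C * int n"
proof -
  let ?Z = "range (\<lambda>j::int. b' [^] j)"
  have Z: "subgroup ?Z G" using subgroup_of_powers assms(4) .
  have "\<exists>C\<ge>0. \<forall>n (k::int). \<forall>z\<in>?Z. b [^] k \<otimes> z \<in> product_ball G T n
    \<longrightarrow> \<bar>k\<bar> \<le> C * (int n + 0 * int n * int n)"
  proof (rule central_power_distortion[OF assms(1,2) _ Z])
    show "b \<in> group_center G" "?Z \<subseteq> group_center G"
      using assms(3,4) by (auto simp: group_center_eq_carrier)
    show "k = 0" if k: "b [^] k \<in> ?Z" for k :: int
    proof -
      obtain j :: int where "b [^] k = b' [^] j" using k by blast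
      then have "b [^] k \<otimes> b' [^] (- j) = \<one>" using assms(4) by (simp add: int_pow_neg)
      then show ?thesis by (rule inf)
    qed
    show "\<exists>i. \<bar>i\<bar> \<le> 0 * int m * int n \<and> x \<otimes> y = b [^] i \<otimes> (y \<otimes> x)"
      if "x \<in> product_ball G T m" "y \<in> product_ball G T n" for m n x y
      using that product_ball_closed[OF assms(2)]
      by (intro exI[of _ 0]) (auto simp: m_comm subset_iff)
  qed simp
  then show ?thesis by auto
qed

text \<open>Generators are again added one at a time. Two elements
  \<open>w \<otimes> s [^] e\<close> with the same \<open>e\<close>, both killed by
  \<open>N\<close>, differ by such an element of the smaller group. So each slice \<open>R e\<close>
  is finite, and finitely many exponents \<open>e\<close> suffice.\<close>

lemma finite_torsion:
  assumes "finite T" "T \<subseteq> carrier G" and gen: "generate G T = carrier G" and N: "N \<noteq> (0::int)"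
  shows "finite {q \<in> carrier G. q [^] N = \<one>}"
proof -
  \<comment> \<open>The subgroup generated by \<open>F\<close>, written as a union of balls so that
    the facts about balls apply.\<close>
  define B where "B F = (\<Union>n. product_ball G F n)" for F
  have Bc: "B F \<subseteq> carrier G" if "F \<subseteq> carrier G" for F
    using product_ball_closed[OF that] by (auto simp: B_def)
  have Bm: "x \<otimes> y \<in> B F" if "F \<subseteq> carrier G" "x \<in> B F" "y \<in> B F" for x y F
    using product_ball_mult[OF that(1)] that(2,3) unfolding B_def by blast
  have Bp: "x [^] (k::int) \<in> B F" if "F \<subseteq> carrier G" "x \<in> B F" for x k F
    using product_ball_int_pow[OF that(1)] that(2) unfolding B_def by blast
  have "finite {q \<in> B F. q [^] N = \<one>}" if "F \<subseteq> T" for F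
    using finite_subset[OF that assms(1)] that
  proof (induction F rule: finite_induct)
    case empty
    have "product_ball G {} n = {\<one>}" for n by (induction n) auto
    then show ?case by (simp add: B_def)
  next
    case (insert s F)
    have Fc: "F \<subseteq> carrier G" and s: "s \<in> carrier G" using insert.prems assms(2) by auto
    have fin: "finite {q \<in> B F. q [^] N = \<one>}" using insert by auto
    have dec: "\<exists>w e. w \<in> B F \<and> x = w \<otimes> s [^] (e::int)" if x: "x \<in> B (insert s F)" for x
    proof -
      obtain n where n: "x \<in> product_ball G (insert s F) n" using x by (auto simp: B_def)
      have comm: "\<exists>i. \<bar>i\<bar> \<le> 0 * int m * int n \<and> x \<otimes> y = \<one> [^] (i::int) \<otimes> (y \<otimes> x)"
        if "x \<in> product_ball G T m" "y \<in> product_ball G T n" for m n x y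
        using that product_ball_closed[OF assms(2)]
        by (intro exI[of _ 0]) (auto simp: m_comm subset_iff)
      \<comment> \<open>With \<one> as the central element and \<open>M = 0\<close> the
        decomposition merely sorts the letters.\<close>
      have "\<exists>w e E. w \<in> product_ball G F n \<and> \<bar>e\<bar> \<le> int n \<and> \<bar>E\<bar> \<le> 0 * int n * int n
        \<and> x = w \<otimes> s [^] (e::int) \<otimes> \<one> [^] (E::int)"
        by (rule product_ball_insert_decompose[OF insert.prems assms(2) _ _ comm n])
          (auto simp: group_center_eq_carrier)
      then obtain w e E where w: "w \<in> product_ball G F n"
        "x = w \<otimes> s [^] (e::int) \<otimes> \<one> [^] (E::int)" by blast
      then have "x = w \<otimes> s [^] e" using product_ball_closed[OF Fc, of n] s by (auto simp: subset_iff)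
      then show ?thesis using w by (auto simp: B_def)
    qed
    define R where "R e = {q. q [^] N = \<one> \<and> (\<exists>w\<in>B F. q = w \<otimes> s [^] (e::int))}" for e
    have finR: "finite (R e)" for e
    proof (cases "R e = {}")
      case False
      then obtain q where q: "q \<in> R e" by blast
      have "R e \<subseteq> (\<lambda>v. v \<otimes> q) ` {v \<in> B F. v [^] N = \<one>}"
      proof
        fix r assume r: "r \<in> R e"
        obtain w w' where w: "w \<in> B F" "q = w \<otimes> s [^] e" "w' \<in> B F" "r = w' \<otimes> s [^] e"
          using q r by (auto simp: R_def)
        have wc: "w \<in> carrier G" "w' \<in> carrier G" using w Bc[OF Fc] by auto
        have qr: "q \<in> carrier G" "r \<in> carrier G" using w wc s by auto
        have "w' \<otimes> w [^] (- 1 :: int) \<in> B F" using Bm[OF Fc w(3) Bp[OF Fc w(1)]] .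
        moreover have "r \<otimes> inv q = w' \<otimes> w [^] (- 1 :: int)"
          using w wc s by (simp add: int_pow_neg inv_mult_group m_assoc[symmetric])
            (simp add: m_assoc)
        moreover have "(r \<otimes> inv q) [^] N = \<one>"
          using q r qr by (simp add: R_def int_pow_distrib int_pow_inv)
        moreover have "r = (r \<otimes> inv q) \<otimes> q" using qr by (simp add: m_assoc)
        ultimately show "r \<in> (\<lambda>v. v \<otimes> q) ` {v \<in> B F. v [^] N = \<one>}" by auto
      qed
      then show ?thesis using fin finite_surj by blast
    qed simp
    show ?case
    proof (cases "\<exists>t::int. t \<noteq> 0 \<and> s [^] t \<in> B F")
      case True
      then obtain t :: int where t: "t \<noteq> 0" "s [^] t \<in> B F" by blast
      \<comment> \<open>Powers of \<open>s [^] t\<close> can be absorbed into \<open>w\<close>, so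
        only the residue of \<open>e\<close> modulo \<open>t\<close> matters.\<close>
      have "{q \<in> B (insert s F). q [^] N = \<one>} \<subseteq> (\<Union>e\<in>{- \<bar>t\<bar>..\<bar>t\<bar>}. R e)"
      proof
        fix q assume q: "q \<in> {q \<in> B (insert s F). q [^] N = \<one>}"
        then obtain w e where w: "w \<in> B F" "q = w \<otimes> s [^] (e::int)" using dec by blast
        have wc: "w \<in> carrier G" using w Bc[OF Fc] by auto
        have "s [^] e = (s [^] t) [^] (e div t) \<otimes> s [^] (e mod t)"
          using s by (simp add: int_pow_pow int_pow_mult[symmetric])
        then have "q = (w \<otimes> (s [^] t) [^] (e div t)) \<otimes> s [^] (e mod t)"
          using w(2) wc s by (simp add: m_assoc)
        moreover have "w \<otimes> (s [^] t) [^] (e div t) \<in> B F"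
          using Bm[OF Fc w(1) Bp[OF Fc t(2)]] .
        ultimately have "q \<in> R (e mod t)" using q by (auto simp: R_def)
        moreover have "e mod t \<in> {- \<bar>t\<bar>..\<bar>t\<bar>}" using abs_mod_less[OF t(1), of e] by auto
        ultimately show "q \<in> (\<Union>e\<in>{- \<bar>t\<bar>..\<bar>t\<bar>}. R e)" by blast
      qed
      moreover have "finite (\<Union>e\<in>{- \<bar>t\<bar>..\<bar>t\<bar>}. R e)" using finR by blast
      ultimately show ?thesis using finite_subset by blast
    next
      case False
      \<comment> \<open>Being the inverse of \<open>w [^] N\<close>, the power
        \<open>s [^] (e * N)\<close> lies in \<open>B F\<close>; in this case that forces
        \<open>e = 0\<close>.\<close>
      have "{q \<in> B (insert s F). q [^] N = \<one>} \<subseteq> R 0"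
      proof
        fix q assume q: "q \<in> {q \<in> B (insert s F). q [^] N = \<one>}"
        then obtain w e where w: "w \<in> B F" "q = w \<otimes> s [^] (e::int)" using dec by blast
        have wc: "w \<in> carrier G" using w Bc[OF Fc] by auto
        have "w [^] N \<otimes> s [^] (e * N) = \<one>"
          using q w(2) wc s by (simp add: int_pow_distrib int_pow_pow)
        then have "s [^] (e * N) = w [^] (- N)"
          using wc s by (simp add: int_pow_neg) (metis int_pow_closed inv_equality m_comm)
        then have "e * N = 0" using False Bp[OF Fc w(1), of "- N"] by metis
        then show "q \<in> R 0" using N q w by (auto simp: R_def)
      qed
      then show ?thesis using finR finite_subset by blast
    qed
  qed
  from this[OF subset_refl] have "finite {q \<in> B T. q [^] N = \<one>}" .
  moreover have "carrier G \<subseteq> B T"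
    using generate_subset_product_balls[OF assms(2)] gen by (auto simp: B_def)
  ultimately show ?thesis 
    using finite_subset[of "{q \<in> carrier G. q [^] N = \<one>}" "{q \<in> B T. q [^] N = \<one>}"] by blast
qed

end

subsection \<open>Central extensions of abelian groups by an infinite cyclic group\<close>

text \<open>The quotient by the central subgroup generated by \<open>c\<close> is kept abstract, as
  a surjection \<pi> onto an abelian group whose kernel is this subgroup. It will be the
  abelianisation of \<open>G\<close>.\<close>

locale heisenberg_extension = group G + Q: comm_group Q
  for G (structure) and Q (structure) +
  fixes \<pi> :: "'a \<Rightarrow> 'c" and c :: 'a and S :: "'a set"
  assumes finite_generating: "finite_generating_set G S"
    and \<pi>_hom: "\<pi> \<in> hom G Q"
    and \<pi>_surj: "\<pi> ` carrier G = carrier Q"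
    and \<pi>_kernel: "\<lbrakk>x \<in> carrier G; \<pi> x = \<one>\<^bsub>Q\<^esub>\<rbrakk> \<Longrightarrow> \<exists>k::int. x = c [^] k"
    and \<pi>_c: "\<pi> c = \<one>\<^bsub>Q\<^esub>"
    and c_center: "c \<in> group_center G"
    and c_infinite_order: "c [^] (k::int) = \<one> \<Longrightarrow> k = 0"
begin

sublocale \<pi>: group_hom G Q \<pi>
  by unfold_locales (rule \<pi>_hom)

lemma S_finite: "finite S" and S_closed: "S \<subseteq> carrier G" and S_generates: "generate G S = carrier G"
  using finite_generating by (auto simp: finite_generating_set_def)

abbreviation ball :: "nat \<Rightarrow> 'a set" where "ball n \<equiv> product_ball G S n"

lemmas ball_mult = product_ball_mult[OF S_closed]
  and ball_inv = product_ball_inv[OF S_closed]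
  and ball_pow = product_ball_int_pow[OF S_closed]

lemma ball_closed: "x \<in> ball n \<Longrightarrow> x \<in> carrier G"
  using product_ball_closed[OF S_closed] by blast

lemma finite_ball: "finite (ball n)"
  by (rule finite_product_ball[OF S_finite])

lemma in_ball: "x \<in> carrier G \<Longrightarrow> \<exists>n. x \<in> ball n"
  using generate_subset_product_balls[OF S_closed] S_generates by blast

section \<open>Powers of the central element and the commutator form\<close>

definition zp :: "int \<Rightarrow> 'a" where "zp k = c [^] k"

lemma c_closed: "c \<in> carrier G"
  using c_center by (rule group_center_closed)

lemma zp_closed [simp]: "zp k \<in> carrier G"
  by (simp add: zp_def c_closed)

lemma zp_0 [simp]: "zp 0 = \<one>" and zp_1: "zp 1 = c"
  by (simp_all add: zp_def c_closed)

lemma zp_zp: "zp i \<otimes> zp j = zp (i + j)"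
  by (simp add: zp_def c_closed int_pow_mult)

lemma zp_zp_left: "x \<in> carrier G \<Longrightarrow> zp i \<otimes> (zp j \<otimes> x) = zp (i + j) \<otimes> x"
  by (simp flip: m_assoc zp_zp)

lemma zp_inv: "inv (zp i) = zp (- i)"
  by (simp add: zp_def c_closed int_pow_neg)

lemma zp_commute: "x \<in> carrier G \<Longrightarrow> x \<otimes> zp i = zp i \<otimes> x"
  unfolding zp_def
  by (rule int_pow_commute[OF c_closed _ group_center_commute[OF c_center], symmetric])

lemma zp_left_commute: "x \<in> carrier G \<Longrightarrow> y \<in> carrier G \<Longrightarrow> x \<otimes> (zp i \<otimes> y) = zp i \<otimes> (x \<otimes> y)"
  by (simp add: zp_commute flip: m_assoc)

lemma zp_inj [simp]: "zp i = zp j \<longleftrightarrow> i = j"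
proof
  assume "zp i = zp j"
  then have "zp (i - j) = \<one>" using zp_zp[of i "- j"] zp_zp[of j "- j"] by simp
  then show "i = j" using c_infinite_order[of "i - j"] by (simp add: zp_def)
qed simp

lemma \<pi>_zp [simp]: "\<pi> (zp k) = \<one>\<^bsub>Q\<^esub>"
  by (simp add: zp_def \<pi>.hom_int_pow c_closed \<pi>_c)

lemma \<pi>_eq_imp:
  assumes "x \<in> carrier G" "y \<in> carrier G" "\<pi> x = \<pi> y"
  shows "\<exists>k. x = zp k \<otimes> y"
proof -
  have "\<pi> (x \<otimes> inv y) = \<one>\<^bsub>Q\<^esub>" using assms by simp
  then obtain k :: int where "x \<otimes> inv y = c [^] k" using \<pi>_kernel[of "x \<otimes> inv y"] assms by auto
  then have "x = zp k \<otimes> y" using assms by (simp add: zp_def[symmetric] inv_solve_right')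
  then show ?thesis by blast
qed

text \<open>The exponent of the commutator of \<open>x\<close> and \<open>y\<close> as a power of
  \<open>c\<close>. It exists because \<open>Q\<close> is abelian and is unique because
  \<open>c\<close> has infinite order.\<close>

definition \<omega> :: "'a \<Rightarrow> 'a \<Rightarrow> int" where
  "\<omega> x y = (THE k. x \<otimes> y = zp k \<otimes> (y \<otimes> x))"

lemma \<omega>_eqI:
  assumes "x \<in> carrier G" "y \<in> carrier G" "x \<otimes> y = zp k \<otimes> (y \<otimes> x)"
  shows "\<omega> x y = k"
  unfolding \<omega>_def using assms by (intro the_equality) auto

lemma \<omega>_commute:
  assumes "x \<in> carrier G" "y \<in> carrier G"
  shows "x \<otimes> y = zp (\<omega> x y) \<otimes> (y \<otimes> x)"
proof -
  obtain k where "x \<otimes> y = zp k \<otimes> (y \<otimes> x)"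
    using \<pi>_eq_imp[of "x \<otimes> y" "y \<otimes> x"] assms Q.m_comm by auto
  then show ?thesis using \<omega>_eqI assms by metis
qed

lemma \<omega>_mult_left:
  assumes "x \<in> carrier G" "x' \<in> carrier G" "y \<in> carrier G"
  shows "\<omega> (x \<otimes> x') y = \<omega> x y + \<omega> x' y"
proof (rule \<omega>_eqI)
  have "x \<otimes> x' \<otimes> y = x \<otimes> (zp (\<omega> x' y) \<otimes> (y \<otimes> x'))"
    using assms \<omega>_commute[of x' y] by (simp add: m_assoc)
  also have "\<dots> = zp (\<omega> x' y) \<otimes> (x \<otimes> y \<otimes> x')"
    using assms by (simp add: zp_left_commute m_assoc)
  also have "\<dots> = zp (\<omega> x' y) \<otimes> (zp (\<omega> x y) \<otimes> (y \<otimes> (x \<otimes> x')))"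
    using assms \<omega>_commute[of x y] by (simp add: m_assoc)
  finally show "x \<otimes> x' \<otimes> y = zp (\<omega> x y + \<omega> x' y) \<otimes> (y \<otimes> (x \<otimes> x'))"
    using assms by (simp add: zp_zp_left add.commute)
qed (use assms in auto)

lemma \<omega>_swap:
  assumes "x \<in> carrier G" "y \<in> carrier G"
  shows "\<omega> y x = - \<omega> x y"
proof (rule \<omega>_eqI)
  have "zp (- \<omega> x y) \<otimes> (x \<otimes> y) = y \<otimes> x"
    using \<omega>_commute[OF assms] assms by (simp add: zp_zp_left)
  then show "y \<otimes> x = zp (- \<omega> x y) \<otimes> (x \<otimes> y)" by simp
qed (use assms in auto)

lemma \<omega>_mult_right:
  assumes "x \<in> carrier G" "y \<in> carrier G" "y' \<in> carrier G"
  shows "\<omega> x (y \<otimes> y') = \<omega> x y + \<omega> x y'"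
  using assms \<omega>_swap[of "y \<otimes> y'" x] \<omega>_swap[of y x] \<omega>_swap[of y' x] \<omega>_mult_left[of y y' x] by simp

lemma \<omega>_zp [simp]: "x \<in> carrier G \<Longrightarrow> \<omega> (zp k) x = 0" "x \<in> carrier G \<Longrightarrow> \<omega> x (zp k) = 0"
  by (rule \<omega>_eqI; simp add: zp_commute)+

lemma \<omega>_self [simp]: "x \<in> carrier G \<Longrightarrow> \<omega> x x = 0"
  by (rule \<omega>_eqI) auto

lemma additive_\<omega>:
  "y \<in> carrier G \<Longrightarrow> additive_on G (carrier G) (\<lambda>x. \<omega> x y)"
  "y \<in> carrier G \<Longrightarrow> additive_on G (carrier G) (\<omega> y)"
  by (auto simp: additive_on_def \<omega>_mult_left \<omega>_mult_right)

lemma \<omega>_pow: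
  assumes "x \<in> carrier G" "y \<in> carrier G"
  shows "\<omega> (x [^] (k::int)) y = k * \<omega> x y" "\<omega> x (y [^] (k::int)) = k * \<omega> x y"
  using additive_on_int_pow[OF subgroup_self additive_\<omega>(1)]
    additive_on_int_pow[OF subgroup_self additive_\<omega>(2)] assms by auto

lemma \<omega>_inv:
  assumes "x \<in> carrier G" "y \<in> carrier G"
  shows "\<omega> x (inv y) = - \<omega> x y"
  using \<omega>_pow(2)[OF assms, of "- 1"] assms by (simp add: int_pow_neg)

lemma conj_eq:
  assumes "g \<in> carrier G" "x \<in> carrier G"
  shows "g \<otimes> x \<otimes> inv g = zp (\<omega> g x) \<otimes> x"
  using \<omega>_commute[OF assms] assms by (simp add: m_assoc)

section \<open>Estimates by the word length\<close>

lemma additive_bounded: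
  assumes f: "additive_on G (carrier G) f" and K: "K \<ge> 0" "\<And>s. s \<in> S \<Longrightarrow> \<bar>f s\<bar> \<le> K"
    and x: "x \<in> ball n"
  shows "\<bar>f x\<bar> \<le> K * int n"
  using x
proof (induction n arbitrary: x)
  case 0
  have "f (\<one> \<otimes> \<one>) = f \<one> + f \<one>" using f unfolding additive_on_def by blast
  then show ?case using 0 by simp
next
  case (Suc n)
  show ?case
  proof (cases "x \<in> ball n")
    case True
    then have "\<bar>f x\<bar> \<le> K * int n" using Suc.IH by blast
    then show ?thesis using K by (simp add: algebra_simps)
  next
    case False
    then obtain a g where ag: "x = a \<otimes> g" "a \<in> S \<union> m_inv G ` S" "g \<in> ball n"
      using Suc.prems by auto
    have c: "a \<in> carrier G" "g \<in> carrier G" using ag S_closed ball_closed by auto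
    have "\<bar>f a\<bar> \<le> K"
    proof (cases "a \<in> S")
      case True
      then show ?thesis using K by blast
    next
      case False
      then obtain s where s: "s \<in> S" "a = inv s" using ag(2) by blast
      then have "s \<in> carrier G" using S_closed by blast
      then show ?thesis
        using additive_on_int_pow[OF subgroup_self f, of s "- 1"] K(2)[of s] s
        by (auto simp: int_pow_neg)
    qed
    moreover have "f x = f a + f g" using f ag(1) c by (auto simp: additive_on_def)
    ultimately show ?thesis using Suc.IH[OF ag(3)] by (simp add: algebra_simps)
  qed
qed

lemma additive_bound_ex:
  assumes "additive_on G (carrier G) f"
  shows "\<exists>K\<ge>0. \<forall>n. \<forall>x\<in>ball n. \<bar>f x\<bar> \<le> K * int n"
proof -
  have fin: "finite (insert 0 ((\<lambda>s. \<bar>f s\<bar>) ` S))" using S_finite by simp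
  have "Max (insert 0 ((\<lambda>s. \<bar>f s\<bar>) ` S)) \<ge> 0" using fin by (intro Max_ge) auto
  moreover have "\<bar>f s\<bar> \<le> Max (insert 0 ((\<lambda>s. \<bar>f s\<bar>) ` S))" if "s \<in> S" for s
    using fin that by (intro Max_ge) auto
  ultimately show ?thesis using additive_bounded[OF assms] by blast
qed

lemma additive_zero:
  assumes "additive_on G (carrier G) f" "\<And>s. s \<in> S \<Longrightarrow> f s = 0" "x \<in> carrier G"
  shows "f x = 0"
proof -
  obtain n where "x \<in> ball n" using in_ball assms(3) by blast
  then have "\<bar>f x\<bar> \<le> 0 * int n" using additive_bounded[OF assms(1), of 0 x n] assms(2) by simp
  then show ?thesis by simp
qed

text \<open>The linear estimate for additive functions, used once in each argument of
  \<omega>.\<close>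

lemma \<omega>_bounded: "\<exists>M\<ge>0. \<forall>m n. \<forall>x\<in>ball m. \<forall>y\<in>ball n. \<bar>\<omega> x y\<bar> \<le> M * int m * int n"
proof -
  let ?A = "insert 0 ((\<lambda>(s, t). \<bar>\<omega> s t\<bar>) ` (S \<times> S))"
  define M where "M = Max ?A"
  have fin: "finite ?A" using S_finite by simp
  have M0: "M \<ge> 0" unfolding M_def using fin by (intro Max_ge) auto
  have MS: "\<bar>\<omega> s t\<bar> \<le> M" if "s \<in> S" "t \<in> S" for s t
    unfolding M_def using fin that by (intro Max_ge) auto
  have 1: "\<bar>\<omega> s y\<bar> \<le> M * int n" if "s \<in> S" "y \<in> ball n" for s y n
    using that MS M0 S_closed by (intro additive_bounded[OF additive_\<omega>(2)]) auto
  have "\<bar>\<omega> x y\<bar> \<le> (M * int n) * int m" if "x \<in> ball m" "y \<in> ball n" for x y m n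
    using additive_bounded[OF additive_\<omega>(1)[OF ball_closed[OF that(2)]] _ 1[OF _ that(2)] that(1)] M0
    by simp
  then show ?thesis using M0 by (intro exI[of _ M]) (auto simp: mult_ac)
qed

text \<open>The general distortion estimate with trivial \<open>Z\<close> and with the bound for
  \<omega> as its \<open>M\<close>. The linear term is absorbed into the quadratic one.\<close>

lemma zp_distortion: "\<exists>C\<ge>0. \<forall>n k. zp k \<in> ball n \<longrightarrow> \<bar>k\<bar> \<le> C * int n * int n"
proof -
  obtain M where M: "M \<ge> 0"
    "\<And>m n x y. x \<in> ball m \<Longrightarrow> y \<in> ball n \<Longrightarrow> \<bar>\<omega> x y\<bar> \<le> M * int m * int n"
    using \<omega>_bounded by blast
  have "\<exists>C\<ge>0. \<forall>n (k::int). \<forall>z\<in>{\<one>}. c [^] k \<otimes> z \<in> product_ball G S n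
    \<longrightarrow> \<bar>k\<bar> \<le> C * (int n + M * int n * int n)"
  proof (rule central_power_distortion[OF S_finite S_closed c_center _ _ _ M(1)])
    show "subgroup {\<one>} G" by (rule triv_subgroup)
    show "{\<one>} \<subseteq> group_center G" using subgroup.one_closed[OF subgroup_group_center] by simp
    show "k = 0" if "c [^] k \<in> {\<one>}" for k :: int using that c_infinite_order by simp
    show "\<exists>i. \<bar>i\<bar> \<le> M * int m * int n \<and> x \<otimes> y = c [^] i \<otimes> (y \<otimes> x)"
      if "x \<in> product_ball G S m" "y \<in> product_ball G S n" for m n x y
      using M(2)[OF that] \<omega>_commute[OF that[THEN ball_closed]] unfolding zp_def by blast
  qed
  then obtain C where C: "C \<ge> 0"
    "\<And>n k. c [^] k \<otimes> \<one> \<in> ball n \<Longrightarrow> \<bar>k\<bar> \<le> C * (int n + M * int n * int n)"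
    by blast
  have "\<bar>k\<bar> \<le> (C * (1 + M)) * int n * int n" if "zp k \<in> ball n" for n k
  proof -
    have "int n \<le> int n * int n" by (cases n) auto
    then have "C * (int n + M * int n * int n) \<le> C * (int n * int n + M * int n * int n)"
      using C by (intro mult_left_mono) auto
    moreover have "c [^] k \<otimes> \<one> \<in> ball n" using that by (simp add: zp_def c_closed)
    then have "\<bar>k\<bar> \<le> C * (int n + M * int n * int n)" by (rule C(2))
    ultimately show ?thesis by (simp add: algebra_simps)
  qed
  then show ?thesis using C M by (intro exI[of _ "C * (1 + M)"]) auto
qed

section \<open>Balls, torsion and distortion in the abelian quotient\<close>

lemma \<pi>_ball: "product_ball Q (\<pi> ` S) n = \<pi> ` ball n"
proof (induction n)
  case (Suc n)
  have inv: "m_inv Q ` \<pi> ` S = \<pi> ` m_inv G ` S"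
    using S_closed by (auto simp: image_iff) (metis \<pi>.hom_inv subsetD)+
  have "{a \<otimes>\<^bsub>Q\<^esub> g |a g. a \<in> \<pi> ` S \<union> m_inv Q ` \<pi> ` S \<and> g \<in> \<pi> ` ball n}
      = \<pi> ` {a \<otimes> g |a g. a \<in> S \<union> m_inv G ` S \<and> g \<in> ball n}" (is "?L = ?R")
  proof -
    have "?L = {\<pi> a \<otimes>\<^bsub>Q\<^esub> \<pi> g |a g. a \<in> S \<union> m_inv G ` S \<and> g \<in> ball n}"
      unfolding inv by blast
    also have "\<dots> = {\<pi> (a \<otimes> g) |a g. a \<in> S \<union> m_inv G ` S \<and> g \<in> ball n}"
    proof -
      have "\<pi> (a \<otimes> g) = \<pi> a \<otimes>\<^bsub>Q\<^esub> \<pi> g" if "a \<in> S \<union> m_inv G ` S" "g \<in> ball n" for a g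
        using that S_closed ball_closed by (intro \<pi>.hom_mult) auto
      then show ?thesis by metis
    qed
    also have "\<dots> = ?R" by blast
    finally show ?thesis .
  qed
  then show ?case using Suc by (simp add: image_Un)
qed simp

lemma finite_Q_torsion:
  assumes "N \<noteq> (0::int)"
  shows "finite {q \<in> carrier Q. q [^]\<^bsub>Q\<^esub> N = \<one>\<^bsub>Q\<^esub>}"
proof (rule Q.finite_torsion[OF _ _ _ assms])
  show "finite (\<pi> ` S)" "\<pi> ` S \<subseteq> carrier Q" using S_finite S_closed by auto
  show "generate Q (\<pi> ` S) = carrier Q"
    using \<pi>.generate_img[OF S_closed] S_generates \<pi>_surj by simp
qed

lemma Q_distortion:
  assumes "x \<in> carrier G" "y \<in> carrier G"
    and "\<And>(i::int) (j::int). \<pi> x [^]\<^bsub>Q\<^esub> i \<otimes>\<^bsub>Q\<^esub> \<pi> y [^]\<^bsub>Q\<^esub> j = \<one>\<^bsub>Q\<^esub> \<Longrightarrow> i = 0"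
  shows "\<exists>C\<ge>0. \<forall>n (i::int) (j::int). \<pi> x [^]\<^bsub>Q\<^esub> i \<otimes>\<^bsub>Q\<^esub> \<pi> y [^]\<^bsub>Q\<^esub> j \<in> \<pi> ` ball n \<longrightarrow> \<bar>i\<bar> \<le> C * int n"
proof -
  have "\<pi> ` S \<subseteq> carrier Q" using S_closed by auto
  then show ?thesis
    using Q.linear_power_distortion[of "\<pi> ` S" "\<pi> x" "\<pi> y"] S_finite assms by (simp add: \<pi>_ball)
qed

lemma twisted_class_id_self: "x \<in> carrier G \<Longrightarrow> x \<in> twisted_class G id x"
  by (auto simp: twisted_class_def intro!: bexI[of _ \<one>])

text \<open>Conjugation changes an element only by a power of \<open>c\<close>, so a conjugacy class
  determines its image under \<pi>. This lower bound for the conjugacy growth serves in all cases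
  but that of finite exponent.\<close>

lemma card_\<pi>_ball_le: "card (\<pi> ` ball n) \<le> card (twisted_class G id ` ball n)"
proof -
  have "card (\<pi> ` {y \<in> ball n. twisted_class G id y = twisted_class G id x}) \<le> 1"
    if x: "x \<in> ball n" for x
  proof -
    have "\<pi> y = \<pi> x" if y: "y \<in> ball n" "twisted_class G id y = twisted_class G id x" for y
    proof -
      have "y \<in> twisted_class G id x" using y twisted_class_id_self ball_closed by blast
      then obtain g where g: "g \<in> carrier G" "y = g \<otimes> x \<otimes> inv g"
        by (auto simp: twisted_class_def)
      then have "y = zp (\<omega> g x) \<otimes> x" using conj_eq x ball_closed by blast
      then show ?thesis using x ball_closed by simp
    qed
    then have "\<pi> ` {y \<in> ball n. twisted_class G id y = twisted_class G id x} \<subseteq> {\<pi> x}" by blast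
    then have "card (\<pi> ` {y \<in> ball n. twisted_class G id y = twisted_class G id x}) \<le> card {\<pi> x}"
      by (intro card_mono) auto
    then show ?thesis by simp
  qed
  from card_image_le_fibres[OF finite_ball this] show ?thesis by simp
qed

end

subsection \<open>Twisted conjugacy classes\<close>

locale heisenberg_endomorphism = heisenberg_extension +
  fixes \<psi> :: "'a \<Rightarrow> 'a" and \<epsilon> :: int
  assumes \<psi>_hom: "\<psi> \<in> hom G G"
    and \<psi>_c: "\<psi> c = c [^] \<epsilon>"
begin

sublocale \<psi>: group_hom G G \<psi>
  by unfold_locales (rule \<psi>_hom)

section \<open>Twisted classes within a fibre of \<pi>\<close>

abbreviation tw :: "'a \<Rightarrow> 'a set" where "tw \<equiv> twisted_class G \<psi>"

lemma tw_subset: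
  assumes x: "x \<in> carrier G" and g: "g \<in> carrier G"
  shows "tw (g \<otimes> x \<otimes> inv (\<psi> g)) \<subseteq> tw x"
proof
  fix z assume "z \<in> tw (g \<otimes> x \<otimes> inv (\<psi> g))"
  then obtain h where h: "h \<in> carrier G" "h \<otimes> (g \<otimes> x \<otimes> inv (\<psi> g)) \<otimes> inv (\<psi> h) = z"
    by (auto simp: twisted_class_def)
  then have "z = (h \<otimes> g) \<otimes> x \<otimes> inv (\<psi> (h \<otimes> g))"
    using x g by (simp add: m_assoc inv_mult_group)
  moreover have "h \<otimes> g \<in> carrier G" "z \<in> carrier G" using h x g by auto
  ultimately show "z \<in> tw x" unfolding twisted_class_def by blast
qed

lemma tw_eq:
  assumes x: "x \<in> carrier G" and g: "g \<in> carrier G"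
  shows "tw (g \<otimes> x \<otimes> inv (\<psi> g)) = tw x"
proof
  show "tw x \<subseteq> tw (g \<otimes> x \<otimes> inv (\<psi> g))"
    using tw_subset[of "g \<otimes> x \<otimes> inv (\<psi> g)" "inv g"] x g by (simp add: m_assoc) (simp flip: m_assoc)
qed (rule tw_subset[OF assms])

text \<open>Powers of \<open>c\<close> are central and pass through twisted conjugation, so a shift
  by \<open>d\<close> that occurs at \<open>x\<close> occurs at every
  \<open>zp j \<otimes> x\<close>, and it can be iterated.\<close>

lemma tw_period:
  assumes x: "x \<in> carrier G" and g: "g \<in> carrier G" and "g \<otimes> x \<otimes> inv (\<psi> g) = zp d \<otimes> x"
  shows "tw (zp (j + d * i) \<otimes> x) = tw (zp j \<otimes> x)"
proof -
  have step: "tw (zp (j + d) \<otimes> x) = tw (zp j \<otimes> x)" for j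
  proof -
    have "g \<otimes> (zp j \<otimes> x) \<otimes> inv (\<psi> g) = zp j \<otimes> (g \<otimes> x \<otimes> inv (\<psi> g))"
      using x g by (simp add: zp_left_commute m_assoc)
    also have "\<dots> = zp (j + d) \<otimes> x" unfolding assms(3) using x by (simp add: zp_zp_left)
    finally show ?thesis using tw_eq[of "zp j \<otimes> x" g] x g by simp
  qed
  show ?thesis
  proof (induction i rule: int_induct[where k = 0])
    case (step1 i)
    then show ?case using step[of "j + d * i"] by (simp add: algebra_simps)
  next
    case (step2 i)
    then show ?case using step[of "j + d * (i - 1)"] by (simp add: algebra_simps)
  qed simp
qed

text \<open>The residue of \<open>k\<close> modulo \<open>d\<close> determines the class. The
  elements of \<open>X\<close> may lie in several fibres of \<pi>, as long as their classes have
  representatives over \<open>x\<close>.\<close>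

lemma card_tw_period_le:
  assumes x: "x \<in> carrier G" and g: "g \<in> carrier G" "g \<otimes> x \<otimes> inv (\<psi> g) = zp d \<otimes> x"
    and d: "d \<noteq> 0" and X: "\<And>y. y \<in> X \<Longrightarrow> \<exists>k. tw y = tw (zp k \<otimes> x)"
  shows "card (tw ` X) \<le> nat \<bar>d\<bar>"
proof -
  have "tw ` X \<subseteq> (\<lambda>j. tw (zp j \<otimes> x)) ` ((\<lambda>k. k mod d) ` UNIV)"
  proof
    fix T assume "T \<in> tw ` X"
    then obtain k where "T = tw (zp k \<otimes> x)" using X by blast
    also have "\<dots> = tw (zp (k mod d) \<otimes> x)" using tw_period[OF x g, of "k mod d" "k div d"] by simp
    finally show "T \<in> (\<lambda>j. tw (zp j \<otimes> x)) ` ((\<lambda>k. k mod d) ` UNIV)" by blast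
  qed
  moreover have "range (\<lambda>k. k mod d) \<subseteq> (if d > 0 then {0..<d} else {d<..0})"
    using d by (auto simp: neg_mod_bound neg_mod_sign)
  then have "finite (range (\<lambda>k. k mod d))" "card (range (\<lambda>k. k mod d)) \<le> nat \<bar>d\<bar>"
    using finite_subset card_mono[of "if d > 0 then {0..<d} else {d<..0}" "range (\<lambda>k. k mod d)"]
    by (auto split: if_splits)
  ultimately show ?thesis
    by (meson card_image_le card_mono finite_imageI order_trans)
qed

text \<open>The endomorphism \<open>1 - \<psi>\<close> of \<open>Q\<close>, in additive notation,
  composed with \<pi>. As a map on \<open>G\<close> it does not require the induced map on
  \<open>Q\<close> to be introduced.\<close>

definition E :: "'a \<Rightarrow> 'c" where "E h = \<pi> (h \<otimes> inv (\<psi> h))"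

lemma E_closed [simp]: "h \<in> carrier G \<Longrightarrow> E h \<in> carrier Q"
  by (simp add: E_def)

lemma E_hom: "E \<in> hom G Q"
proof (rule homI)
  fix x y assume xy: "x \<in> carrier G" "y \<in> carrier G"
  then show "E (x \<otimes> y) = E x \<otimes>\<^bsub>Q\<^esub> E y"
    by (simp add: E_def inv_mult_group Q.inv_mult Q.m_ac)
qed simp

sublocale E: group_hom G Q E
  by unfold_locales (rule E_hom)

lemma \<pi>_twist:
  assumes "x \<in> carrier G" "h \<in> carrier G"
  shows "\<pi> (h \<otimes> x \<otimes> inv (\<psi> h)) = \<pi> x \<otimes>\<^bsub>Q\<^esub> E h"
  using assms by (simp add: E_def Q.m_ac)

definition Fix :: "'a set" where "Fix = {f \<in> carrier G. E f = \<one>\<^bsub>Q\<^esub>}"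

lemma subgroup_Fix: "subgroup Fix G"
  using E.subgroup_kernel by (simp add: Fix_def kernel_def)

lemma Fix_closed: "f \<in> Fix \<Longrightarrow> f \<in> carrier G"
  by (simp add: Fix_def)

text \<open>The defect of \<open>f\<close> from being fixed by \<psi>, as an exponent of
  \<open>c\<close>. On \<open>Fix\<close> it exists and is unique; values elsewhere carry no
  meaning.\<close>

definition \<mu> :: "'a \<Rightarrow> int" where "\<mu> f = (THE k. f \<otimes> inv (\<psi> f) = zp k)"

lemma \<mu>_eqI: "f \<otimes> inv (\<psi> f) = zp k \<Longrightarrow> \<mu> f = k"
  unfolding \<mu>_def by (intro the_equality) auto

lemma Fix_\<mu>: "f \<in> Fix \<Longrightarrow> f \<otimes> inv (\<psi> f) = zp (\<mu> f)"
proof -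
  assume "f \<in> Fix"
  then have "\<exists>k. f \<otimes> inv (\<psi> f) = zp k \<otimes> \<one>"
    by (intro \<pi>_eq_imp) (auto simp: Fix_def E_def)
  then show ?thesis using \<mu>_eqI by auto
qed

lemma additive_\<mu>: "additive_on G Fix \<mu>"
  unfolding additive_on_def
proof (intro ballI \<mu>_eqI)
  fix f g assume fg: "f \<in> Fix" "g \<in> Fix"
  then have c: "f \<in> carrier G" "g \<in> carrier G" by (auto simp: Fix_def)
  have "f \<otimes> g \<otimes> inv (\<psi> (f \<otimes> g)) = f \<otimes> (g \<otimes> inv (\<psi> g)) \<otimes> inv (\<psi> f)"
    using c by (simp add: inv_mult_group m_assoc)
  also have "\<dots> = zp (\<mu> g) \<otimes> (f \<otimes> inv (\<psi> f))"
    using c by (simp add: Fix_\<mu>[OF fg(2)] zp_commute m_assoc)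
  also have "\<dots> = zp (\<mu> f + \<mu> g)" by (simp add: Fix_\<mu>[OF fg(1)] zp_zp add.commute)
  finally show "f \<otimes> g \<otimes> inv (\<psi> (f \<otimes> g)) = zp (\<mu> f + \<mu> g)" .
qed

text \<open>Moving \<open>f\<close> past \<open>x\<close> produces the commutator part, and
  \<open>f \<otimes> inv (\<psi> f)\<close> the constant part. Elements of \<open>Fix\<close> thus
  move \<open>x\<close> within its fibre of \<pi>, and this is the source of all periods
  below.\<close>

lemma Fix_twist:
  assumes f: "f \<in> Fix" and x: "x \<in> carrier G"
  shows "f \<otimes> x \<otimes> inv (\<psi> f) = zp (\<omega> f x + \<mu> f) \<otimes> x"
proof -
  have c: "f \<in> carrier G" using f by (rule Fix_closed)
  have "f \<otimes> x \<otimes> inv (\<psi> f) = zp (\<omega> f x) \<otimes> (x \<otimes> (f \<otimes> inv (\<psi> f)))"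
    using \<omega>_commute[OF c x] c x by (simp add: m_assoc)
  also have "\<dots> = zp (\<omega> f x) \<otimes> (zp (\<mu> f) \<otimes> x)"
    using x by (simp add: Fix_\<mu>[OF f] zp_commute)
  finally show ?thesis using x by (simp add: zp_zp_left)
qed

lemma \<psi>_zp: "\<psi> (zp k) = zp (\<epsilon> * k)"
  by (simp add: zp_def \<psi>.hom_int_pow c_closed \<psi>_c int_pow_pow)

text \<open>As \<open>c\<close> is central, vanishing of \<mu> on the central elements of
  \<open>Fix\<close> will force \<open>\<epsilon> = 1\<close>.\<close>

lemma zp_Fix: "zp k \<in> Fix" and \<mu>_c: "\<mu> c = 1 - \<epsilon>"
proof -
  have "zp k \<otimes> inv (\<psi> (zp k)) = zp (k - \<epsilon> * k)" for k
    by (simp add: \<psi>_zp zp_inv zp_zp)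
  note eq = this
  show "zp k \<in> Fix" by (simp add: Fix_def E_def eq del: \<pi>.hom_mult)
  show "\<mu> c = 1 - \<epsilon>" using \<mu>_eqI[OF eq[of 1]] by (simp add: zp_1)
qed

text \<open>For central \<open>f\<close> the commutator part of the shift vanishes, so the period
  \<open>\<mu> f\<close> is the same in every fibre of \<pi>.\<close>

lemma growth_central_twist:
  assumes f: "f \<in> Fix" "f \<in> group_center G" and d: "\<mu> f \<noteq> 0"
  shows "card (tw ` ball n) \<le> nat \<bar>\<mu> f\<bar> * card (\<pi> ` ball n)"
proof (rule card_image_le_fibres[OF finite_ball])
  fix x assume x: "x \<in> ball n"
  have xc: "x \<in> carrier G" and fc: "f \<in> carrier G" using x ball_closed f(1) Fix_closed by auto
  have "\<omega> f x = 0" using group_center_commute[OF f(2) xc] xc fc by (intro \<omega>_eqI) auto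
  then have per: "f \<otimes> x \<otimes> inv (\<psi> f) = zp (\<mu> f) \<otimes> x" using Fix_twist[OF f(1) xc] by simp
  show "card (tw ` {y \<in> ball n. \<pi> y = \<pi> x}) \<le> nat \<bar>\<mu> f\<bar>"
  proof (rule card_tw_period_le[OF xc fc per d])
    fix y assume "y \<in> {y \<in> ball n. \<pi> y = \<pi> x}"
    then show "\<exists>k. tw y = tw (zp k \<otimes> x)" using \<pi>_eq_imp[of y x] xc ball_closed by auto
  qed
qed


text \<open>The image in \<^term>\<open>Q\<close> of the orbit of \<open>x\<close> under twisted conjugation by the elements
  \<open>u\<^sup>i v\<^sup>j\<close>.\<close>

definition orb :: "'a \<Rightarrow> 'a \<Rightarrow> 'a \<Rightarrow> 'c set" where
  "orb u v x = {\<pi> x \<otimes>\<^bsub>Q\<^esub> (E u [^]\<^bsub>Q\<^esub> i \<otimes>\<^bsub>Q\<^esub> E v [^]\<^bsub>Q\<^esub> j) | (i::int) (j::int). True}"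

section \<open>Orbits in \<open>Q\<close> and the classes lying over them\<close>

lemma orb_eqD:
  assumes "x \<in> carrier G" "y \<in> carrier G" "u \<in> carrier G" "v \<in> carrier G" "orb u v y = orb u v x"
  shows "\<exists>(i::int) (j::int). \<pi> y = \<pi> x \<otimes>\<^bsub>Q\<^esub> (E u [^]\<^bsub>Q\<^esub> i \<otimes>\<^bsub>Q\<^esub> E v [^]\<^bsub>Q\<^esub> j)"
proof -
  have "\<pi> y = \<pi> y \<otimes>\<^bsub>Q\<^esub> (E u [^]\<^bsub>Q\<^esub> (0::int) \<otimes>\<^bsub>Q\<^esub> E v [^]\<^bsub>Q\<^esub> (0::int))" using assms by simp
  then have "\<pi> y \<in> orb u v y" unfolding orb_def by blast
  then show ?thesis using assms(5) unfolding orb_def by blast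
qed

lemma orb_subset:
  assumes "x \<in> carrier G" "y \<in> carrier G" "u \<in> carrier G" "v \<in> carrier G"
    and "\<pi> y = \<pi> x \<otimes>\<^bsub>Q\<^esub> (E u [^]\<^bsub>Q\<^esub> (i::int) \<otimes>\<^bsub>Q\<^esub> E v [^]\<^bsub>Q\<^esub> (j::int))"
  shows "orb u v y \<subseteq> orb u v x"
proof
  fix q assume "q \<in> orb u v y"
  then obtain i' j' :: int where "q = \<pi> y \<otimes>\<^bsub>Q\<^esub> (E u [^]\<^bsub>Q\<^esub> i' \<otimes>\<^bsub>Q\<^esub> E v [^]\<^bsub>Q\<^esub> j')"
    unfolding orb_def by blast
  then have "q = \<pi> x \<otimes>\<^bsub>Q\<^esub> (E u [^]\<^bsub>Q\<^esub> (i + i') \<otimes>\<^bsub>Q\<^esub> E v [^]\<^bsub>Q\<^esub> (j + j'))"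
    using assms by (simp add: Q.int_pow_mult Q.m_ac)
  then show "q \<in> orb u v x" unfolding orb_def by blast
qed

lemma orb_eqI:
  assumes "x \<in> carrier G" "y \<in> carrier G" "u \<in> carrier G" "v \<in> carrier G"
    and "\<pi> y = \<pi> x \<otimes>\<^bsub>Q\<^esub> (E u [^]\<^bsub>Q\<^esub> (i::int) \<otimes>\<^bsub>Q\<^esub> E v [^]\<^bsub>Q\<^esub> (j::int))"
  shows "orb u v y = orb u v x"
proof
  show "orb u v y \<subseteq> orb u v x" using orb_subset assms by blast
  have "\<pi> x = \<pi> y \<otimes>\<^bsub>Q\<^esub> (E u [^]\<^bsub>Q\<^esub> (- i) \<otimes>\<^bsub>Q\<^esub> E v [^]\<^bsub>Q\<^esub> (- j))"
  proof -
    have "\<pi> y \<otimes>\<^bsub>Q\<^esub> (E u [^]\<^bsub>Q\<^esub> (- i) \<otimes>\<^bsub>Q\<^esub> E v [^]\<^bsub>Q\<^esub> (- j))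
      = \<pi> x \<otimes>\<^bsub>Q\<^esub> (E u [^]\<^bsub>Q\<^esub> i \<otimes>\<^bsub>Q\<^esub> E u [^]\<^bsub>Q\<^esub> (- i)) \<otimes>\<^bsub>Q\<^esub> (E v [^]\<^bsub>Q\<^esub> j \<otimes>\<^bsub>Q\<^esub> E v [^]\<^bsub>Q\<^esub> (- j))"
      unfolding assms(5) using assms(1-4) by (simp add: Q.m_ac)
    then show ?thesis using assms(1-4) by (simp add: Q.int_pow_neg)
  qed
  then show "orb u v x \<subseteq> orb u v y" using orb_subset[OF assms(2,1,3,4)] by blast
qed

lemma E_word:
  assumes "u \<in> carrier G" "v \<in> carrier G"
  shows "E (u [^] (i::int) \<otimes> v [^] (j::int)) = E u [^]\<^bsub>Q\<^esub> i \<otimes>\<^bsub>Q\<^esub> E v [^]\<^bsub>Q\<^esub> j"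
  using assms by (simp add: E.hom_int_pow)

text \<open>Undoing the twisted conjugation by \<open>h\<close> brings \<open>y\<close> into the
  fibre of \<open>x\<close> without changing its class. The explicit \<open>h\<close> is kept
  because its length will bound \<open>k\<close>.\<close>

lemma orb_tw:
  assumes x: "x \<in> carrier G" and y: "y \<in> carrier G" and uv: "u \<in> carrier G" "v \<in> carrier G"
    and eq: "\<pi> y = \<pi> x \<otimes>\<^bsub>Q\<^esub> (E u [^]\<^bsub>Q\<^esub> (i::int) \<otimes>\<^bsub>Q\<^esub> E v [^]\<^bsub>Q\<^esub> (j::int))"
  shows "\<exists>k h. h = u [^] i \<otimes> v [^] j \<and> y = zp k \<otimes> (h \<otimes> x \<otimes> inv (\<psi> h)) \<and> tw y = tw (zp k \<otimes> x)"
proof -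
  define h where "h = u [^] i \<otimes> v [^] j"
  have h: "h \<in> carrier G" using uv by (simp add: h_def)
  have "\<pi> y = \<pi> (h \<otimes> x \<otimes> inv (\<psi> h))"
    unfolding eq using \<pi>_twist[OF x h] E_word[OF uv] by (simp add: h_def)
  then obtain k where k: "y = zp k \<otimes> (h \<otimes> x \<otimes> inv (\<psi> h))"
    using \<pi>_eq_imp[of y "h \<otimes> x \<otimes> inv (\<psi> h)"] x y h by auto
  have "y = h \<otimes> (zp k \<otimes> x) \<otimes> inv (\<psi> h)"
    unfolding k using x h by (simp add: zp_left_commute m_assoc)
  then have "tw y = tw (zp k \<otimes> x)" using tw_eq[of "zp k \<otimes> x" h] x h by simp
  then show ?thesis using k h_def by blast
qed

text \<open>All classes over one orbit have representatives over a single point \<open>x\<close>,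
  where \<open>\<omega> f x + \<mu> f\<close> is a period. It is at most linear in \<open>n\<close>;
  its constant part is absorbed because \<open>n \<ge> 1\<close>.\<close>

lemma card_tw_linear:
  assumes f: "f \<in> Fix" and uv: "u \<in> carrier G" "v \<in> carrier G"
  shows "\<exists>C. \<forall>n\<ge>1. \<forall>X. X \<subseteq> {x \<in> ball n. \<omega> f x + \<mu> f \<noteq> 0}
    \<longrightarrow> card (tw ` X) \<le> C * n * card (orb u v ` X)"
proof -
  have fc: "f \<in> carrier G" using f by (rule Fix_closed)
  obtain K where K: "K \<ge> 0" "\<And>n x. x \<in> ball n \<Longrightarrow> \<bar>\<omega> f x\<bar> \<le> K * int n"
    using additive_bound_ex[OF additive_\<omega>(2)[OF fc]] by blast
  define C where "C = nat (K + \<bar>\<mu> f\<bar>)"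
  have "card (tw ` X) \<le> C * n * card (orb u v ` X)"
    if n: "n \<ge> 1" and X: "X \<subseteq> {x \<in> ball n. \<omega> f x + \<mu> f \<noteq> 0}" for n X
  proof (rule card_image_le_fibres)
    show "finite X" by (rule finite_subset[OF _ finite_ball[of n]]) (use X in blast)
    fix x assume "x \<in> X"
    then have x: "x \<in> ball n" "x \<in> carrier G" "\<omega> f x + \<mu> f \<noteq> 0" using X ball_closed by auto
    have "card (tw ` {y \<in> X. orb u v y = orb u v x}) \<le> nat \<bar>\<omega> f x + \<mu> f\<bar>"
    proof (rule card_tw_period_le[OF x(2) fc Fix_twist[OF f x(2)] x(3)])
      fix y assume y: "y \<in> {y \<in> X. orb u v y = orb u v x}"
      then have yc: "y \<in> carrier G" using X ball_closed by blast
      show "\<exists>k. tw y = tw (zp k \<otimes> x)"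
        using orb_eqD[OF x(2) yc uv] orb_tw[OF x(2) yc uv] y by blast
    qed
    also have "\<bar>\<omega> f x + \<mu> f\<bar> \<le> K * int n + \<bar>\<mu> f\<bar> * int n"
      using K(2)[OF x(1)] n mult_left_mono[of 1 "int n" "\<bar>\<mu> f\<bar>"] by simp
    then have "nat \<bar>\<omega> f x + \<mu> f\<bar> \<le> C * n"
      using K(1) by (simp add: C_def nat_le_iff algebra_simps)
    finally show "card (tw ` {y \<in> X. orb u v y = orb u v x}) \<le> C * n" .
  qed
  then show ?thesis by blast
qed

text \<open>Instead of a period, the distortion of \<open>c\<close> is used: \<open>zp k = y
  \<otimes> inv (h \<otimes> x \<otimes> inv (\<psi> h))\<close> has length linear in
  \<open>n\<close>, so \<open>k\<close> is at most quadratic. The hypothesis \<open>ctrl\<close>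
  makes the exponents in \<open>h\<close> linear in \<open>n\<close>; it allows them to be replaced
  since \<open>E v\<close> may be trivial.\<close>

lemma card_tw_quadratic:
  assumes uv: "u \<in> carrier G" "v \<in> carrier G"
    and ctrl: "\<exists>C\<ge>0. \<forall>n (i::int) (j::int). E u [^]\<^bsub>Q\<^esub> i \<otimes>\<^bsub>Q\<^esub> E v [^]\<^bsub>Q\<^esub> j \<in> \<pi> ` ball n
      \<longrightarrow> (\<exists>(i'::int) (j'::int). \<bar>i'\<bar> \<le> C * int n \<and> \<bar>j'\<bar> \<le> C * int n
        \<and> E u [^]\<^bsub>Q\<^esub> i' \<otimes>\<^bsub>Q\<^esub> E v [^]\<^bsub>Q\<^esub> j' = E u [^]\<^bsub>Q\<^esub> i \<otimes>\<^bsub>Q\<^esub> E v [^]\<^bsub>Q\<^esub> j)"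
  shows "\<exists>C. \<forall>n\<ge>1. \<forall>X. X \<subseteq> ball n \<longrightarrow> card (tw ` X) \<le> C * (n * n) * card (orb u v ` X)"
proof -
  obtain C0 where C0: "C0 \<ge> 0"
    "\<And>n (i::int) (j::int). E u [^]\<^bsub>Q\<^esub> i \<otimes>\<^bsub>Q\<^esub> E v [^]\<^bsub>Q\<^esub> j \<in> \<pi> ` ball n
      \<Longrightarrow> \<exists>(i'::int) (j'::int). \<bar>i'\<bar> \<le> C0 * int n \<and> \<bar>j'\<bar> \<le> C0 * int n
        \<and> E u [^]\<^bsub>Q\<^esub> i' \<otimes>\<^bsub>Q\<^esub> E v [^]\<^bsub>Q\<^esub> j' = E u [^]\<^bsub>Q\<^esub> i \<otimes>\<^bsub>Q\<^esub> E v [^]\<^bsub>Q\<^esub> j"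
    using ctrl by metis
  \<comment> \<open>Two points of \<open>ball n\<close> differ by an element of
    \<open>ball (n + n)\<close>, whence the factor 2.\<close>
  define D where "D = nat C0 * 2"
  obtain L where L: "{u, v, \<psi> u, \<psi> v} \<subseteq> ball L"
    using finite_subset_product_ball[OF finite_generating, of "{u, v, \<psi> u, \<psi> v}"] uv by auto
  \<comment> \<open>In the word for \<open>zp k\<close>, the elements \<open>y\<close> and
    \<open>x\<close> contribute length \<open>2 * n\<close>, and \<open>h\<close> and
    \<open>\<psi> h\<close> at most \<open>2 * D * L * n\<close> each.\<close>
  define P where "P = 2 + 4 * D * L"
  obtain C1 where C1: "C1 \<ge> 0" "\<And>n k. zp k \<in> ball n \<Longrightarrow> \<bar>k\<bar> \<le> C1 * int n * int n"
    using zp_distortion by blast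
  define B where "B = nat C1 * (P * P)"
  have "card (tw ` X) \<le> (2 * B + 1) * (n * n) * card (orb u v ` X)"
    if n: "n \<ge> 1" and X: "X \<subseteq> ball n" for n X
  proof (rule card_image_le_fibres)
    show "finite X" using X finite_ball finite_subset by blast
    fix x assume "x \<in> X"
    then have x: "x \<in> ball n" "x \<in> carrier G" using X ball_closed by auto
    let ?K = "int (B * (n * n))"
    have "tw ` {y \<in> X. orb u v y = orb u v x} \<subseteq> (\<lambda>k. tw (zp k \<otimes> x)) ` {- ?K..?K}"
    proof
      fix T assume "T \<in> tw ` {y \<in> X. orb u v y = orb u v x}"
      then obtain y where y: "T = tw y" "y \<in> ball n" "orb u v y = orb u v x" using X by blast
      have yc: "y \<in> carrier G" using y(2) by (rule ball_closed)
      obtain i j :: int where ij: "\<pi> y = \<pi> x \<otimes>\<^bsub>Q\<^esub> (E u [^]\<^bsub>Q\<^esub> i \<otimes>\<^bsub>Q\<^esub> E v [^]\<^bsub>Q\<^esub> j)"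
        using orb_eqD[OF x(2) yc uv y(3)] by blast
      have "E u [^]\<^bsub>Q\<^esub> i \<otimes>\<^bsub>Q\<^esub> E v [^]\<^bsub>Q\<^esub> j = \<pi> (inv x \<otimes> y)"
        using x yc uv by (simp add: ij Q.m_assoc[symmetric])
      moreover have "inv x \<otimes> y \<in> ball (n + n)"
        using ball_mult[OF ball_inv[OF x(1)] y(2)] .
      ultimately have "E u [^]\<^bsub>Q\<^esub> i \<otimes>\<^bsub>Q\<^esub> E v [^]\<^bsub>Q\<^esub> j \<in> \<pi> ` ball (n + n)" by simp
      from C0(2)[OF this] obtain i' j' :: int where ij': "\<bar>i'\<bar> \<le> C0 * int (n + n)"
        "\<bar>j'\<bar> \<le> C0 * int (n + n)"
        "E u [^]\<^bsub>Q\<^esub> i' \<otimes>\<^bsub>Q\<^esub> E v [^]\<^bsub>Q\<^esub> j' = E u [^]\<^bsub>Q\<^esub> i \<otimes>\<^bsub>Q\<^esub> E v [^]\<^bsub>Q\<^esub> j" by blast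
      have le: "nat \<bar>i'\<bar> \<le> D * n" "nat \<bar>j'\<bar> \<le> D * n"
        using ij'(1,2) C0(1) by (simp_all add: D_def nat_le_iff)
      obtain k h where h: "h = u [^] i' \<otimes> v [^] j'" and k: "y = zp k \<otimes> (h \<otimes> x \<otimes> inv (\<psi> h))"
        "tw y = tw (zp k \<otimes> x)"
        using orb_tw[OF x(2) yc uv, of i' j'] ij ij'(3) by metis
      have hc: "h \<in> carrier G" using h uv by simp
      have pw: "a [^] e \<in> ball (D * n * L)" if "a \<in> ball L" "nat \<bar>e\<bar> \<le> D * n" for a and e :: int
      proof -
        have "nat \<bar>e\<bar> * L \<le> D * n * L" using that(2) by (rule mult_le_mono1)
        then show ?thesis using ball_pow[OF that(1), of e] product_ball_mono by blast
      qed
      have h_ball: "h \<in> ball (D * n * L + D * n * L)"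
        unfolding h using L le by (intro ball_mult pw) auto
      have "\<psi> h = \<psi> u [^] i' \<otimes> \<psi> v [^] j'"
        unfolding h using uv by (simp add: \<psi>.hom_int_pow)
      then have \<psi>_ball: "\<psi> h \<in> ball (D * n * L + D * n * L)"
        using L le by (auto intro!: ball_mult pw)
      have "zp k = y \<otimes> inv (h \<otimes> x \<otimes> inv (\<psi> h))"
        unfolding k(1) using x hc by (simp add: m_assoc)
      moreover have "y \<otimes> inv (h \<otimes> x \<otimes> inv (\<psi> h))
          \<in> ball (n + ((D * n * L + D * n * L) + n + (D * n * L + D * n * L)))"
        by (intro ball_mult ball_inv y x h_ball \<psi>_ball)
      moreover have "n + ((D * n * L + D * n * L) + n + (D * n * L + D * n * L)) = P * n"
        by (simp add: P_def algebra_simps)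
      ultimately have "zp k \<in> ball (P * n)" by simp
      then have "\<bar>k\<bar> \<le> C1 * int (P * n) * int (P * n)" by (rule C1(2))
      also have "\<dots> = ?K" using C1(1) by (simp add: B_def mult_ac)
      finally have "k \<in> {- ?K..?K}" by auto
      then show "T \<in> (\<lambda>k. tw (zp k \<otimes> x)) ` {- ?K..?K}" using k(2) y(1) by blast
    qed
    then have "card (tw ` {y \<in> X. orb u v y = orb u v x}) \<le> card {- ?K..?K}"
      by (meson card_image_le card_mono finite_atLeastAtMost_int finite_imageI order_trans)
    also have "\<dots> = 2 * (B * (n * n)) + 1" by (simp del: of_nat_mult)
    also have "\<dots> \<le> (2 * B + 1) * (n * n)" using n by (simp add: algebra_simps)
    finally show "card (tw ` {y \<in> X. orb u v y = orb u v x}) \<le> (2 * B + 1) * (n * n)" .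
  qed
  then show ?thesis by blast
qed

text \<open>The images in \<open>Q\<close> of the translates of \<open>x\<close> along
  \<open>p\<close> and \<open>q\<close> with exponents in \<open>J\<close> reveal \<open>h x\<close>
  and, for a given \<open>x\<close>, the exponents. So one family of translates for each value of
  \<open>h\<close> can be packed without overlap.\<close>

definition separates :: "'a \<Rightarrow> 'a \<Rightarrow> ('a \<Rightarrow> 'e) \<Rightarrow> 'a set \<Rightarrow> (int \<times> int) set \<Rightarrow> bool" where
  "separates p q h X J \<longleftrightarrow> (\<forall>x\<in>X. \<forall>y\<in>X. \<forall>i j i' j'. (i, j) \<in> J \<longrightarrow> (i', j') \<in> J
    \<longrightarrow> \<pi> (x \<otimes> (p [^] i \<otimes> q [^] j)) = \<pi> (y \<otimes> (p [^] i' \<otimes> q [^] j'))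
    \<longrightarrow> h x = h y \<and> (x = y \<longrightarrow> i = i' \<and> j = j'))"

text \<open>Translating points of \<open>ball n\<close> with exponents below \<open>n\<close> stays
  within a radius linear in \<open>n\<close>. A set \<open>J\<close> of size \<open>n\<close> or
  \<open>n * n\<close> then pays for linearly or quadratically many classes per orbit.\<close>

lemma card_packing:
  assumes pq: "p \<in> carrier G" "q \<in> carrier G"
  shows "\<exists>C. \<forall>n X J. X \<subseteq> ball n \<longrightarrow> J \<subseteq> {0..<int n} \<times> {0..<int n} \<longrightarrow> separates p q h X J
    \<longrightarrow> card (h ` X) * card J \<le> card (\<pi> ` ball (C * n))"
proof -
  obtain L where L: "{p, q} \<subseteq> ball L"
    using finite_subset_product_ball[OF finite_generating, of "{p, q}"] pq by auto
  have "card (h ` X) * card J \<le> card (\<pi> ` ball ((1 + 2 * L) * n))"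
    if X: "X \<subseteq> ball n" and J: "J \<subseteq> {0..<int n} \<times> {0..<int n}"
      and sep: "separates p q h X J" for n X J
  proof (rule card_image_mult_le[where \<theta> = "\<lambda>x (i, j). \<pi> (x \<otimes> (p [^] i \<otimes> q [^] j))"])
    show "finite (\<pi> ` ball ((1 + 2 * L) * n))" using finite_ball by simp
    fix x e assume x: "x \<in> X" and e: "e \<in> J"
    obtain i j where ij: "e = (i, j)" by force
    then have "(i, j) \<in> {0..<int n} \<times> {0..<int n}" using e J by blast
    then have "nat \<bar>i\<bar> \<le> n" "nat \<bar>j\<bar> \<le> n" by auto
    then have "nat \<bar>i\<bar> * L \<le> n * L" "nat \<bar>j\<bar> * L \<le> n * L" by (simp_all only: mult_le_mono1)
    then have "p [^] i \<in> ball (n * L)" "q [^] j \<in> ball (n * L)"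
      using ball_pow[of p L i] ball_pow[of q L j] L product_ball_mono by blast+
    then have "x \<otimes> (p [^] i \<otimes> q [^] j) \<in> ball (n + (n * L + n * L))"
      using x X by (intro ball_mult) auto
    moreover have "n + (n * L + n * L) = (1 + 2 * L) * n" by (simp add: algebra_simps)
    ultimately show "(\<lambda>(i, j). \<pi> (x \<otimes> (p [^] i \<otimes> q [^] j))) e \<in> \<pi> ` ball ((1 + 2 * L) * n)"
      by (simp only: ij prod.case imageI)
  next
    fix x x' e e'
    assume a: "x \<in> X" "x' \<in> X" "e \<in> J" "e' \<in> J"
      "(\<lambda>(i, j). \<pi> (x \<otimes> (p [^] i \<otimes> q [^] j))) e = (\<lambda>(i, j). \<pi> (x' \<otimes> (p [^] i \<otimes> q [^] j))) e'"
    obtain i j i' j' where "e = (i, j)" "e' = (i', j')" by (metis surj_pair)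
    then show "h x = h x'" using sep[unfolded separates_def, rule_format, of x x' i j i' j'] a by simp
  next
    fix x e e'
    assume a: "x \<in> X" "e \<in> J" "e' \<in> J"
      "(\<lambda>(i, j). \<pi> (x \<otimes> (p [^] i \<otimes> q [^] j))) e = (\<lambda>(i, j). \<pi> (x \<otimes> (p [^] i \<otimes> q [^] j))) e'"
    obtain i j i' j' where "e = (i, j)" "e' = (i', j')" by (metis surj_pair)
    then show "e = e'" using sep[unfolded separates_def, rule_format, of x x i j i' j'] a by simp
  qed
  then show ?thesis by (intro exI[of _ "1 + 2 * L"]) blast
qed


section \<open>Growth when \<open>1 - \<psi>\<close> has infinite order on \<open>Q\<close>\<close>

lemma \<pi>_ball_mono: "m \<le> n \<Longrightarrow> card (\<pi> ` ball m) \<le> card (\<pi> ` ball n)"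
  by (intro card_mono image_mono product_ball_mono finite_imageI finite_ball)

text \<open>The ball is split by whether the shift \<open>\<omega> f x + \<mu> f\<close> vanishes.
  Where it does not, there are linearly many classes per orbit and translates along \<open>p\<close>
  suffice. Where it does, there are quadratically many, but \<open>\<omega> f\<close> is constant
  there and varies along \<open>v\<close>, which makes \<open>v\<close> a second direction for
  packing.\<close>

lemma growth_noncentral_fixed:
  assumes \<epsilon>: "\<epsilon> = 1" and f: "f \<in> Fix" and v: "v \<in> carrier G" "\<omega> f v \<noteq> 0"
    and a: "a \<in> carrier G" and inf: "\<And>k::int. E a [^]\<^bsub>Q\<^esub> k = \<one>\<^bsub>Q\<^esub> \<Longrightarrow> k = 0"
  shows "\<exists>C. \<forall>n\<ge>1. card (tw ` ball n) \<le> C * card (\<pi> ` ball (C * n))"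
proof -
  define p where "p = a \<otimes> inv (\<psi> a)"
  have p: "p \<in> carrier G" "\<pi> p = E a" using a by (auto simp: p_def E_def)
  have fc: "f \<in> carrier G" using f by (rule Fix_closed)
  \<comment> \<open>Only powers of \<open>E a\<close> have to be controlled, so the second direction
    is taken trivial.\<close>
  obtain Cd where Cd: "Cd \<ge> 0" "\<And>n (i::int) (j::int).
      \<pi> p [^]\<^bsub>Q\<^esub> i \<otimes>\<^bsub>Q\<^esub> \<pi> \<one> [^]\<^bsub>Q\<^esub> j \<in> \<pi> ` ball n \<Longrightarrow> \<bar>i\<bar> \<le> Cd * int n"
  proof -
    have "i = 0" if "\<pi> p [^]\<^bsub>Q\<^esub> i \<otimes>\<^bsub>Q\<^esub> \<pi> \<one> [^]\<^bsub>Q\<^esub> j = \<one>\<^bsub>Q\<^esub>" for i j :: int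
      using that inf[of i] a by (simp add: p(2))
    then have "\<exists>C\<ge>0. \<forall>n (i::int) (j::int). \<pi> p [^]\<^bsub>Q\<^esub> i \<otimes>\<^bsub>Q\<^esub> \<pi> \<one> [^]\<^bsub>Q\<^esub> j \<in> \<pi> ` ball n
        \<longrightarrow> \<bar>i\<bar> \<le> C * int n"
      using Q_distortion p(1) one_closed by blast
    then show ?thesis using that by blast
  qed
  have "\<exists>C\<ge>0. \<forall>n (i::int) (j::int). E a [^]\<^bsub>Q\<^esub> i \<otimes>\<^bsub>Q\<^esub> E \<one> [^]\<^bsub>Q\<^esub> j \<in> \<pi> ` ball n
      \<longrightarrow> (\<exists>(i'::int) (j'::int). \<bar>i'\<bar> \<le> C * int n \<and> \<bar>j'\<bar> \<le> C * int n
        \<and> E a [^]\<^bsub>Q\<^esub> i' \<otimes>\<^bsub>Q\<^esub> E \<one> [^]\<^bsub>Q\<^esub> j' = E a [^]\<^bsub>Q\<^esub> i \<otimes>\<^bsub>Q\<^esub> E \<one> [^]\<^bsub>Q\<^esub> j)"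
  proof (rule exI[of _ Cd], intro conjI allI impI Cd(1))
    fix n and i j :: int
    assume "E a [^]\<^bsub>Q\<^esub> i \<otimes>\<^bsub>Q\<^esub> E \<one> [^]\<^bsub>Q\<^esub> j \<in> \<pi> ` ball n"
    then have "\<bar>i\<bar> \<le> Cd * int n" using Cd(2)[of i j n] by (simp add: p)
    then show "\<exists>(i'::int) (j'::int). \<bar>i'\<bar> \<le> Cd * int n \<and> \<bar>j'\<bar> \<le> Cd * int n
        \<and> E a [^]\<^bsub>Q\<^esub> i' \<otimes>\<^bsub>Q\<^esub> E \<one> [^]\<^bsub>Q\<^esub> j' = E a [^]\<^bsub>Q\<^esub> i \<otimes>\<^bsub>Q\<^esub> E \<one> [^]\<^bsub>Q\<^esub> j"
      using Cd(1) by (intro exI[of _ i] exI[of _ 0]) auto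
  qed
  from card_tw_quadratic[OF a one_closed this] obtain C2 where
    C2: "\<And>n X. n \<ge> 1 \<Longrightarrow> X \<subseteq> ball n \<Longrightarrow> card (tw ` X) \<le> C2 * (n * n) * card (orb a \<one> ` X)"
    by blast
  obtain C1 where
    C1: "\<And>n X. n \<ge> 1 \<Longrightarrow> X \<subseteq> {x \<in> ball n. \<omega> f x + \<mu> f \<noteq> 0}
      \<Longrightarrow> card (tw ` X) \<le> C1 * n * card (orb a \<one> ` X)"
    using card_tw_linear[OF f a one_closed] by blast
  obtain C3 where
    C3: "\<And>n X J. \<lbrakk>X \<subseteq> ball n; J \<subseteq> {0..<int n} \<times> {0..<int n}; separates p v (orb a \<one>) X J\<rbrakk>
      \<Longrightarrow> card (orb a \<one> ` X) * card J \<le> card (\<pi> ` ball (C3 * n))"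
    using card_packing[OF p(1) v(1), of "orb a \<one>"] by blast
  \<comment> \<open>When the exponents of \<open>v\<close> agree, this factor cancels and
    \<open>\<pi> x\<close> differs from \<open>\<pi> y\<close> by a power of
    \<open>E a\<close>.\<close>
  have separate: "orb a \<one> x = orb a \<one> y \<and> (x = y \<longrightarrow> i = i')"
    if x: "x \<in> carrier G" and y: "y \<in> carrier G"
      and eq: "\<pi> (x \<otimes> (p [^] i \<otimes> v [^] j)) = \<pi> (y \<otimes> (p [^] i' \<otimes> v [^] j))" for x y and i j i' :: int
  proof -
    have "\<pi> x \<otimes>\<^bsub>Q\<^esub> E a [^]\<^bsub>Q\<^esub> i \<otimes>\<^bsub>Q\<^esub> \<pi> v [^]\<^bsub>Q\<^esub> j = \<pi> y \<otimes>\<^bsub>Q\<^esub> E a [^]\<^bsub>Q\<^esub> i' \<otimes>\<^bsub>Q\<^esub> \<pi> v [^]\<^bsub>Q\<^esub> j"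
      using eq x y v p a by (simp add: \<pi>.hom_int_pow Q.m_assoc)
    then have "\<pi> x \<otimes>\<^bsub>Q\<^esub> E a [^]\<^bsub>Q\<^esub> i = \<pi> y \<otimes>\<^bsub>Q\<^esub> E a [^]\<^bsub>Q\<^esub> i'" using x y v a by simp
    then have "\<pi> x = \<pi> y \<otimes>\<^bsub>Q\<^esub> E a [^]\<^bsub>Q\<^esub> i' \<otimes>\<^bsub>Q\<^esub> inv\<^bsub>Q\<^esub> (E a [^]\<^bsub>Q\<^esub> i)"
      using x y a by (simp add: Q.inv_solve_right)
    then have \<pi>x: "\<pi> x = \<pi> y \<otimes>\<^bsub>Q\<^esub> E a [^]\<^bsub>Q\<^esub> (i' - i)"
      using x y a by (simp add: Q.int_pow_diff Q.m_assoc)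
    then have "orb a \<one> x = orb a \<one> y"
      using x y a by (intro orb_eqI[of y x a \<one> "i' - i" 0]) auto
    moreover have "i = i'" if "x = y"
    proof -
      have "E a [^]\<^bsub>Q\<^esub> (i' - i) = \<one>\<^bsub>Q\<^esub>" using \<pi>x x y a by (simp add: that)
      then show ?thesis using inf by fastforce
    qed
    ultimately show ?thesis by blast
  qed
  \<comment> \<open>Because \<open>\<epsilon> = 1\<close>, the map \<psi> preserves \<omega>, and
    \<open>f\<close> differs from \<open>\<psi> f\<close> by a power of \<open>c\<close>. So
    \<open>f\<close> pairs equally with \<open>a\<close> and \<open>\<psi> a\<close>, hence
    trivially with \<open>p\<close>.\<close>
  have \<omega>p: "\<omega> f p = 0"
  proof -
    have comm: "\<psi> x \<otimes> \<psi> y = zp (\<omega> x y) \<otimes> (\<psi> y \<otimes> \<psi> x)" if "x \<in> carrier G" "y \<in> carrier G" for x y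
    proof -
      have "\<psi> (x \<otimes> y) = \<psi> (zp (\<omega> x y) \<otimes> (y \<otimes> x))" using \<omega>_commute[OF that] by simp
      then show ?thesis using that by (simp add: \<psi>_zp \<epsilon>)
    qed
    have "\<omega> (\<psi> f) (\<psi> a) = \<omega> f a" by (rule \<omega>_eqI[OF _ _ comm]) (use fc a in auto)
    moreover have "f = zp (\<mu> f) \<otimes> \<psi> f"
    proof -
      have "f = f \<otimes> inv (\<psi> f) \<otimes> \<psi> f" using fc by (simp add: m_assoc)
      then show ?thesis by (simp only: Fix_\<mu>[OF f])
    qed
    then have "\<omega> f (\<psi> a) = \<omega> (\<psi> f) (\<psi> a)"
      using \<omega>_mult_left[of "zp (\<mu> f)" "\<psi> f" "\<psi> a"] fc a by simp
    ultimately show ?thesis using fc a by (simp add: p_def \<omega>_mult_right \<omega>_inv)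
  qed
  have main: "card (tw ` ball n) \<le> (C1 + C2) * card (\<pi> ` ball (C3 * n))" if n: "n \<ge> 1" for n
  proof -
    define X1 where "X1 = {x \<in> ball n. \<omega> f x + \<mu> f \<noteq> 0}"
    define X2 where "X2 = {x \<in> ball n. \<omega> f x + \<mu> f = 0}"
    have X: "X1 \<subseteq> ball n" "X2 \<subseteq> ball n" by (auto simp: X1_def X2_def)
    \<comment> \<open>Off the hyperplane one direction is enough, so the exponent of
      \<open>v\<close> is kept at 0.\<close>
    have "separates p v (orb a \<one>) X1 ({0..<int n} \<times> {0})"
      unfolding separates_def
    proof (intro ballI allI impI)
      fix x y and i j i' j' :: int
      assume xy: "x \<in> X1" "y \<in> X1"
        and j: "(i, j) \<in> {0..<int n} \<times> {0}" "(i', j') \<in> {0..<int n} \<times> {0}"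
        and eq: "\<pi> (x \<otimes> (p [^] i \<otimes> v [^] j)) = \<pi> (y \<otimes> (p [^] i' \<otimes> v [^] j'))"
      have "x \<in> carrier G" "y \<in> carrier G" using xy X ball_closed by blast+
      from separate[OF this, of i 0 i'] show "orb a \<one> x = orb a \<one> y \<and> (x = y \<longrightarrow> i = i' \<and> j = j')"
        using eq j by simp
    qed
    then have "card (orb a \<one> ` X1) * card ({0..<int n} \<times> {0::int}) \<le> card (\<pi> ` ball (C3 * n))"
      using n by (intro C3 X) auto
    then have 1: "n * card (orb a \<one> ` X1) \<le> card (\<pi> ` ball (C3 * n))"
      by (simp add: card_cartesian_product mult.commute)
    have "separates p v (orb a \<one>) X2 ({0..<int n} \<times> {0..<int n})"
      unfolding separates_def
    proof (intro ballI allI impI)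
      fix x y and i j i' j' :: int
      assume xy: "x \<in> X2" "y \<in> X2"
        and eq: "\<pi> (x \<otimes> (p [^] i \<otimes> v [^] j)) = \<pi> (y \<otimes> (p [^] i' \<otimes> v [^] j'))"
      have c: "x \<in> carrier G" "y \<in> carrier G" using xy X ball_closed by blast+
      obtain k where k: "x \<otimes> (p [^] i \<otimes> v [^] j) = zp k \<otimes> (y \<otimes> (p [^] i' \<otimes> v [^] j'))"
        using \<pi>_eq_imp[OF _ _ eq] c p v by auto
      \<comment> \<open>Applying \<open>\<omega> f\<close> to both sides removes \<open>p\<close>;
        on \<open>X2\<close> its values at \<open>x\<close> and \<open>y\<close> are both
        \<open>- \<mu> f\<close>, so the exponents of \<open>v\<close> must agree.\<close>
      have "\<omega> f x + j * \<omega> f v = \<omega> f y + j' * \<omega> f v"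
        using arg_cong[OF k, of "\<omega> f"] c fc v p by (simp add: \<omega>_mult_right \<omega>_pow \<omega>p)
      moreover have "\<omega> f x + \<mu> f = 0" "\<omega> f y + \<mu> f = 0" using xy unfolding X2_def by blast+
      ultimately have "j * \<omega> f v = j' * \<omega> f v" by linarith
      then have "j = j'" using v(2) by simp
      then show "orb a \<one> x = orb a \<one> y \<and> (x = y \<longrightarrow> i = i' \<and> j = j')"
        using separate[OF c, of i j i'] eq by blast
    qed
    then have "card (orb a \<one> ` X2) * card ({0..<int n} \<times> {0..<int n}) \<le> card (\<pi> ` ball (C3 * n))"
      by (intro C3 X) auto
    then have 2: "(n * n) * card (orb a \<one> ` X2) \<le> card (\<pi> ` ball (C3 * n))"
      by (simp add: card_cartesian_product mult.commute)
    have "tw ` ball n = tw ` X1 \<union> tw ` X2" by (auto simp: X1_def X2_def)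
    then have "card (tw ` ball n) \<le> card (tw ` X1) + card (tw ` X2)" by (simp only: card_Un_le)
    also have "\<dots> \<le> C1 * n * card (orb a \<one> ` X1) + C2 * (n * n) * card (orb a \<one> ` X2)"
      using n X by (intro add_mono C1 C2) (auto simp: X1_def)
    also have "\<dots> \<le> C1 * card (\<pi> ` ball (C3 * n)) + C2 * card (\<pi> ` ball (C3 * n))"
      using add_mono[OF mult_le_mono2[OF 1, of C1] mult_le_mono2[OF 2, of C2]] by (simp only: mult.assoc)
    finally show ?thesis by (simp add: algebra_simps)
  qed
  have "card (tw ` ball n) \<le> (C1 + C2 + C3) * card (\<pi> ` ball ((C1 + C2 + C3) * n))"
    if "n \<ge> 1" for n
  proof -
    have "(C1 + C2) * card (\<pi> ` ball (C3 * n)) \<le> (C1 + C2 + C3) * card (\<pi> ` ball ((C1 + C2 + C3) * n))"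
      by (intro mult_le_mono \<pi>_ball_mono) auto
    then show ?thesis using main[OF that] by (rule order_trans[rotated])
  qed
  then show ?thesis by blast
qed

text \<open>An element \<open>u [^] i \<otimes> v [^] j\<close> killed by \<open>E\<close> is
  central, which is incompatible with \<open>\<omega> u v \<noteq> 0\<close> unless both exponents
  vanish. Thus \<open>E u\<close> and \<open>E v\<close> are independent, and \<open>n * n\<close>
  translates along them absorb the quadratically many classes per orbit.\<close>

lemma growth_fixed_central:
  assumes central: "Fix \<subseteq> group_center G"
    and uv: "u \<in> carrier G" "v \<in> carrier G" "\<omega> u v \<noteq> 0"
  shows "\<exists>C. \<forall>n\<ge>1. card (tw ` ball n) \<le> C * card (\<pi> ` ball (C * n))"
proof -
  define p q where "p = u \<otimes> inv (\<psi> u)" and "q = v \<otimes> inv (\<psi> v)"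
  have pq: "p \<in> carrier G" "\<pi> p = E u" "q \<in> carrier G" "\<pi> q = E v"
    using uv by (auto simp: p_def q_def E_def)
  have indep: "i = 0 \<and> j = 0" if "E u [^]\<^bsub>Q\<^esub> i \<otimes>\<^bsub>Q\<^esub> E v [^]\<^bsub>Q\<^esub> j = \<one>\<^bsub>Q\<^esub>" for i j :: int
  proof -
    let ?w = "u [^] i \<otimes> v [^] j"
    have "?w \<in> Fix" using that uv E_word[OF uv(1,2)] by (simp add: Fix_def del: E.hom_mult)
    then have w: "?w \<in> group_center G" using central by blast
    have "\<omega> ?w x = 0" if "x \<in> carrier G" for x
    proof (rule \<omega>_eqI)
      show "?w \<otimes> x = zp 0 \<otimes> (x \<otimes> ?w)" using group_center_commute[OF w that] that uv by simp
    qed (use that uv in auto)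
    \<comment> \<open>Pairing with \<open>v\<close> isolates \<open>i\<close>, and pairing with
      \<open>u\<close> isolates \<open>j\<close>.\<close>
    then have "\<omega> ?w v = 0" "\<omega> ?w u = 0" using uv by auto
    then have "i * \<omega> u v = 0" "j * \<omega> v u = 0"
      using uv by (simp_all add: \<omega>_mult_left \<omega>_pow)
    then show ?thesis using uv(3) \<omega>_swap[of u v] uv by auto
  qed
  have flip: "E v [^]\<^bsub>Q\<^esub> j \<otimes>\<^bsub>Q\<^esub> E u [^]\<^bsub>Q\<^esub> i = E u [^]\<^bsub>Q\<^esub> i \<otimes>\<^bsub>Q\<^esub> E v [^]\<^bsub>Q\<^esub> j" for i j :: int
    using uv by (intro Q.m_comm) auto
  obtain Cu where Cu: "Cu \<ge> 0" "\<And>n (i::int) (j::int).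
      E u [^]\<^bsub>Q\<^esub> i \<otimes>\<^bsub>Q\<^esub> E v [^]\<^bsub>Q\<^esub> j \<in> \<pi> ` ball n \<Longrightarrow> \<bar>i\<bar> \<le> Cu * int n"
  proof -
    have "i = 0" if "\<pi> p [^]\<^bsub>Q\<^esub> i \<otimes>\<^bsub>Q\<^esub> \<pi> q [^]\<^bsub>Q\<^esub> j = \<one>\<^bsub>Q\<^esub>" for i j :: int
      using that indep[of i j] by (simp add: pq)
    then have "\<exists>C\<ge>0. \<forall>n (i::int) (j::int). \<pi> p [^]\<^bsub>Q\<^esub> i \<otimes>\<^bsub>Q\<^esub> \<pi> q [^]\<^bsub>Q\<^esub> j \<in> \<pi> ` ball n
        \<longrightarrow> \<bar>i\<bar> \<le> C * int n"
      using Q_distortion pq(1,3) by blast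
    then show ?thesis using that unfolding pq by blast
  qed
  \<comment> \<open>The distortion estimate controls only the first exponent, so it is used again
    with the two directions exchanged.\<close>
  obtain Cv where Cv: "Cv \<ge> 0" "\<And>n (i::int) (j::int).
      E v [^]\<^bsub>Q\<^esub> i \<otimes>\<^bsub>Q\<^esub> E u [^]\<^bsub>Q\<^esub> j \<in> \<pi> ` ball n \<Longrightarrow> \<bar>i\<bar> \<le> Cv * int n"
  proof -
    have "i = 0" if "\<pi> q [^]\<^bsub>Q\<^esub> i \<otimes>\<^bsub>Q\<^esub> \<pi> p [^]\<^bsub>Q\<^esub> j = \<one>\<^bsub>Q\<^esub>" for i j :: int
      using that indep[of j i] by (simp add: pq flip)
    then have "\<exists>C\<ge>0. \<forall>n (i::int) (j::int). \<pi> q [^]\<^bsub>Q\<^esub> i \<otimes>\<^bsub>Q\<^esub> \<pi> p [^]\<^bsub>Q\<^esub> j \<in> \<pi> ` ball n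
        \<longrightarrow> \<bar>i\<bar> \<le> C * int n"
      using Q_distortion pq(1,3) by blast
    then show ?thesis using that unfolding pq by blast
  qed
  have "\<exists>C\<ge>0. \<forall>n (i::int) (j::int). E u [^]\<^bsub>Q\<^esub> i \<otimes>\<^bsub>Q\<^esub> E v [^]\<^bsub>Q\<^esub> j \<in> \<pi> ` ball n
      \<longrightarrow> (\<exists>(i'::int) (j'::int). \<bar>i'\<bar> \<le> C * int n \<and> \<bar>j'\<bar> \<le> C * int n
        \<and> E u [^]\<^bsub>Q\<^esub> i' \<otimes>\<^bsub>Q\<^esub> E v [^]\<^bsub>Q\<^esub> j' = E u [^]\<^bsub>Q\<^esub> i \<otimes>\<^bsub>Q\<^esub> E v [^]\<^bsub>Q\<^esub> j)"
  proof (rule exI[of _ "Cu + Cv"], intro conjI allI impI)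
    show "Cu + Cv \<ge> 0" using Cu Cv by simp
    fix n and i j :: int
    assume as: "E u [^]\<^bsub>Q\<^esub> i \<otimes>\<^bsub>Q\<^esub> E v [^]\<^bsub>Q\<^esub> j \<in> \<pi> ` ball n"
    then have "\<bar>j\<bar> \<le> Cv * int n" using Cv(2)[of j i n] by (simp add: flip)
    moreover have "\<bar>i\<bar> \<le> Cu * int n" using Cu(2)[OF as] .
    moreover have "0 \<le> Cu * int n" "0 \<le> Cv * int n" using Cu(1) Cv(1) by auto
    ultimately have "\<bar>i\<bar> \<le> (Cu + Cv) * int n" "\<bar>j\<bar> \<le> (Cu + Cv) * int n"
      by (simp_all add: algebra_simps)
    then show "\<exists>(i'::int) (j'::int). \<bar>i'\<bar> \<le> (Cu + Cv) * int n \<and> \<bar>j'\<bar> \<le> (Cu + Cv) * int n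
        \<and> E u [^]\<^bsub>Q\<^esub> i' \<otimes>\<^bsub>Q\<^esub> E v [^]\<^bsub>Q\<^esub> j' = E u [^]\<^bsub>Q\<^esub> i \<otimes>\<^bsub>Q\<^esub> E v [^]\<^bsub>Q\<^esub> j"
      by blast
  qed
  from card_tw_quadratic[OF uv(1,2) this] obtain C2 where
    C2: "\<And>n X. n \<ge> 1 \<Longrightarrow> X \<subseteq> ball n \<Longrightarrow> card (tw ` X) \<le> C2 * (n * n) * card (orb u v ` X)"
    by blast
  obtain C3 where
    C3: "\<And>n X J. \<lbrakk>X \<subseteq> ball n; J \<subseteq> {0..<int n} \<times> {0..<int n}; separates p q (orb u v) X J\<rbrakk>
      \<Longrightarrow> card (orb u v ` X) * card J \<le> card (\<pi> ` ball (C3 * n))"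
    using card_packing[OF pq(1,3), of "orb u v"] by blast
  have "card (tw ` ball n) \<le> (C2 + C3) * card (\<pi> ` ball ((C2 + C3) * n))" if n: "n \<ge> 1" for n
  proof -
    have "separates p q (orb u v) (ball n) ({0..<int n} \<times> {0..<int n})"
      unfolding separates_def
    proof (intro ballI allI impI)
      fix x y and i j i' j' :: int
      assume xy: "x \<in> ball n" "y \<in> ball n"
        and eq: "\<pi> (x \<otimes> (p [^] i \<otimes> q [^] j)) = \<pi> (y \<otimes> (p [^] i' \<otimes> q [^] j'))"
      have c: "x \<in> carrier G" "y \<in> carrier G" using xy ball_closed by auto
      have "\<pi> x \<otimes>\<^bsub>Q\<^esub> (E u [^]\<^bsub>Q\<^esub> i \<otimes>\<^bsub>Q\<^esub> E v [^]\<^bsub>Q\<^esub> j) = \<pi> y \<otimes>\<^bsub>Q\<^esub> (E u [^]\<^bsub>Q\<^esub> i' \<otimes>\<^bsub>Q\<^esub> E v [^]\<^bsub>Q\<^esub> j')"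
        using eq c pq by (simp add: \<pi>.hom_int_pow)
      then have "\<pi> x = \<pi> y \<otimes>\<^bsub>Q\<^esub> (E u [^]\<^bsub>Q\<^esub> i' \<otimes>\<^bsub>Q\<^esub> E v [^]\<^bsub>Q\<^esub> j')
          \<otimes>\<^bsub>Q\<^esub> inv\<^bsub>Q\<^esub> (E u [^]\<^bsub>Q\<^esub> i \<otimes>\<^bsub>Q\<^esub> E v [^]\<^bsub>Q\<^esub> j)"
        using c uv by (simp add: Q.inv_solve_right)
      also have "\<dots> = \<pi> y \<otimes>\<^bsub>Q\<^esub> (E u [^]\<^bsub>Q\<^esub> (i' - i) \<otimes>\<^bsub>Q\<^esub> E v [^]\<^bsub>Q\<^esub> (j' - j))"
        using c uv by (simp add: Q.int_pow_diff Q.inv_mult Q.m_ac)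
      finally have \<pi>x: "\<pi> x = \<pi> y \<otimes>\<^bsub>Q\<^esub> (E u [^]\<^bsub>Q\<^esub> (i' - i) \<otimes>\<^bsub>Q\<^esub> E v [^]\<^bsub>Q\<^esub> (j' - j))" .
      then have "orb u v x = orb u v y" using orb_eqI[OF c(2,1) uv(1,2)] by blast
      moreover have "i = i' \<and> j = j'" if "x = y"
      proof -
        have "E u [^]\<^bsub>Q\<^esub> (i' - i) \<otimes>\<^bsub>Q\<^esub> E v [^]\<^bsub>Q\<^esub> (j' - j) = \<one>\<^bsub>Q\<^esub>"
          using \<pi>x c uv by (simp add: that)
        then show ?thesis using indep[of "i' - i" "j' - j"] by simp
      qed
      ultimately show "orb u v x = orb u v y \<and> (x = y \<longrightarrow> i = i' \<and> j = j')" by blast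
    qed
    then have "card (orb u v ` ball n) * card ({0..<int n} \<times> {0..<int n}) \<le> card (\<pi> ` ball (C3 * n))"
      by (intro C3) auto
    then have "(n * n) * card (orb u v ` ball n) \<le> card (\<pi> ` ball (C3 * n))"
      by (simp add: card_cartesian_product mult.commute)
    then have "C2 * ((n * n) * card (orb u v ` ball n)) \<le> C2 * card (\<pi> ` ball (C3 * n))"
      by (rule mult_le_mono2)
    also have "\<dots> \<le> (C2 + C3) * card (\<pi> ` ball ((C2 + C3) * n))"
      by (intro mult_le_mono \<pi>_ball_mono) auto
    finally show ?thesis using C2[OF n subset_refl] by (simp add: mult.assoc)
  qed
  then show ?thesis by blast
qed


section \<open>Growth when \<open>1 - \<psi>\<close> has finite exponent on \<open>Q\<close>\<close>

lemma uniform_E_torsion: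
  assumes "\<And>a. a \<in> carrier G \<Longrightarrow> \<exists>k::int. E a [^]\<^bsub>Q\<^esub> k = \<one>\<^bsub>Q\<^esub> \<and> k \<noteq> 0"
  shows "\<exists>m::nat. m > 0 \<and> (\<forall>g\<in>carrier G. g [^] int m \<in> Fix)"
proof -
  obtain k :: "'a \<Rightarrow> int" where k: "\<And>a. a \<in> carrier G \<Longrightarrow> E a [^]\<^bsub>Q\<^esub> k a = \<one>\<^bsub>Q\<^esub> \<and> k a \<noteq> 0"
    using assms by metis
  \<comment> \<open>A common multiple of exponents killing \<open>E s\<close> for the generators
    \<open>s\<close> kills the whole image of \<open>E\<close>, as \<open>Q\<close> is
    abelian.\<close>
  define m where "m = (\<Prod>s\<in>S. nat \<bar>k s\<bar>)"
  have m: "m > 0" using k S_closed S_finite by (auto simp: m_def intro!: prod_pos)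
  have Em: "E g [^]\<^bsub>Q\<^esub> int m = \<one>\<^bsub>Q\<^esub>" if "g \<in> generate G S" for g
    using that
  proof (induction rule: generate.induct)
    case one
    then show ?case by simp
  next
    case gen: (incl s)
    have sc: "s \<in> carrier G" using gen S_closed by blast
    have "nat \<bar>k s\<bar> dvd m" unfolding m_def using gen S_finite by (intro dvd_prodI)
    then have "k s dvd int m" by (metis abs_dvd_iff dvd_nat_abs_iff int_dvd_int_iff nat_abs_dvd_iff nat_int_comparison(1))
    then obtain e where "int m = k s * e" by blast
    then show ?case using k[OF sc] sc Q.int_pow_pow[of "E s" "k s" e] by (simp add: Q.int_pow_one)
  next
    case gen: (inv s)
    have sc: "s \<in> carrier G" using gen S_closed by blast
    have "nat \<bar>k s\<bar> dvd m" unfolding m_def using gen S_finite by (intro dvd_prodI)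
    then have "k s dvd int m" by (metis abs_dvd_iff dvd_nat_abs_iff int_dvd_int_iff nat_abs_dvd_iff nat_int_comparison(1))
    then obtain e where "int m = k s * e" by blast
    then have "E s [^]\<^bsub>Q\<^esub> int m = \<one>\<^bsub>Q\<^esub>"
      using k[OF sc] sc Q.int_pow_pow[of "E s" "k s" e] by (simp add: Q.int_pow_one)
    then show ?case using sc by (simp add: Q.int_pow_inv)
  next
    case (eng g h)
    then have "g \<in> carrier G" "h \<in> carrier G" using S_generates by auto
    then show ?case using eng.IH by (simp add: Q.int_pow_distrib)
  qed
  have "g [^] int m \<in> Fix" if "g \<in> carrier G" for g
    using Em[of g] that S_generates by (simp add: Fix_def E.hom_int_pow)
  then show ?thesis using m by blast
qed

text \<open>An element of \<open>Fix\<close> pairing trivially with all generators is central, and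
  there \<mu> vanishes. By linear algebra a multiple of \<mu> is a combination of the pairings with
  generators, which additivity of \<omega> turns into the pairing with one element.\<close>

lemma \<mu>_eq_\<omega>:
  assumes central: "\<And>f. f \<in> Fix \<Longrightarrow> f \<in> group_center G \<Longrightarrow> \<mu> f = 0"
  shows "\<exists>N y. N \<noteq> 0 \<and> y \<in> carrier G \<and> (\<forall>f\<in>Fix. N * \<mu> f = \<omega> f y)"
proof -
  have "\<exists>N n. N \<noteq> 0 \<and> (\<forall>f\<in>Fix. N * \<mu> f = (\<Sum>s\<in>S. n s * \<omega> f s))"
  proof (rule additive_on_dependent[OF S_finite subgroup_Fix _ additive_\<mu>])
    show "additive_on G Fix (\<lambda>f. \<omega> f s)" if "s \<in> S" for s
      using additive_\<omega>(1)[of s] that S_closed Fix_closed by (auto simp: additive_on_def)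
    fix f assume f: "f \<in> Fix" and zero: "\<And>s. s \<in> S \<Longrightarrow> \<omega> f s = 0"
    have fc: "f \<in> carrier G" using f by (rule Fix_closed)
    have "f \<otimes> x = x \<otimes> f" if "x \<in> carrier G" for x
      using additive_zero[OF additive_\<omega>(2)[OF fc] zero that] \<omega>_commute[OF fc that] fc that by simp
    then have "f \<in> group_center G" using fc by (simp add: group_center_def)
    then show "\<mu> f = 0" using central f by blast
  qed
  then obtain N n where N: "N \<noteq> 0" "\<And>f. f \<in> Fix \<Longrightarrow> N * \<mu> f = (\<Sum>s\<in>S. n s * \<omega> f s)" by blast
  \<comment> \<open>The witness is the product of the powers \<open>s [^] n s\<close>, built up one
    generator at a time.\<close>
  have "\<exists>y\<in>carrier G. \<forall>f\<in>carrier G. \<omega> f y = (\<Sum>s\<in>F. n s * \<omega> f s)" if "F \<subseteq> S" for F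
    using finite_subset[OF that S_finite] that
  proof (induction F rule: finite_induct)
    case empty
    show ?case using \<omega>_zp(2)[of _ 0] by (intro bexI[of _ \<one>]) auto
  next
    case (insert s F)
    then obtain y where y: "y \<in> carrier G" "\<forall>f\<in>carrier G. \<omega> f y = (\<Sum>s\<in>F. n s * \<omega> f s)" by blast
    have s: "s \<in> carrier G" using insert.prems S_closed by blast
    have "\<omega> f (s [^] n s \<otimes> y) = (\<Sum>s\<in>insert s F. n s * \<omega> f s)" if "f \<in> carrier G" for f
      using y s that insert.hyps by (simp add: \<omega>_mult_right \<omega>_pow)
    then show ?case using y s by (intro bexI[of _ "s [^] n s \<otimes> y"]) auto
  qed
  from this[OF subset_refl] show ?thesis using N Fix_closed by metis
qed

text \<open>From \<open>N * \<mu> f = \<omega> f y\<close> follows \<open>N * (\<omega> f r + \<mu>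
  f) = \<omega> f (r [^] N \<otimes> y)\<close>: up to the factor \<open>N\<close>, twisted shifts
  of \<open>r\<close> by elements of \<open>Fix\<close> are ordinary conjugation shifts of
  \<open>r [^] N \<otimes> y\<close>. So \<open>zp j \<otimes> r\<close> is sent to the conjugacy
  class of \<open>zp j \<otimes> (r [^] N \<otimes> y)\<close>. A value is shared by at most
  \<open>card Tor\<close> fibres of \<pi>, and by at most \<open>m\<close> twisted classes in
  each.\<close>

lemma growth_finite_order:
  assumes central: "\<And>f. f \<in> Fix \<Longrightarrow> f \<in> group_center G \<Longrightarrow> \<mu> f = 0"
    and m: "m > 0" "\<And>g. g \<in> carrier G \<Longrightarrow> g [^] int m \<in> Fix"
  shows "\<exists>C. \<forall>n\<ge>1. card (tw ` ball n) \<le> C * card (twisted_class G id ` ball (C * n))"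
proof -
  obtain N y where N: "N \<noteq> 0" and y: "y \<in> carrier G" and \<mu>: "\<And>f. f \<in> Fix \<Longrightarrow> N * \<mu> f = \<omega> f y"
    using \<mu>_eq_\<omega>[OF central] by blast
  define Tor where "Tor = {q \<in> carrier Q. q [^]\<^bsub>Q\<^esub> N = \<one>\<^bsub>Q\<^esub>}"
  have Tor: "finite Tor" unfolding Tor_def by (rule finite_Q_torsion[OF N])
  obtain L where L: "y \<in> ball L" using in_ball[OF y] by blast
  \<comment> \<open>The 2 pays for \<open>x\<close> and \<open>inv (r x)\<close>, the other terms
    for \<open>r x [^] N\<close> and \<open>y\<close>.\<close>
  define C where "C = 2 + nat \<bar>N\<bar> + L"
  have "card (tw ` ball n) \<le> (m * card Tor) * card (twisted_class G id ` ball (C * n))" if n: "n \<ge> 1" for n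
  proof -
    \<comment> \<open>A representative of the fibre chosen inside the ball. It depends on
      \<open>\<pi> x\<close> alone, and \<open>x \<otimes> inv (r x)\<close> is a power of
      \<open>c\<close>.\<close>
    define r where "r x = inv_into (ball n) \<pi> (\<pi> x)" for x
    have r: "r x \<in> ball n" "\<pi> (r x) = \<pi> x" if "x \<in> ball n" for x
      using that by (auto simp: r_def inv_into_into f_inv_into_f)
    define w where "w x = r x [^] N \<otimes> y" for x
    define h where "h x = twisted_class G id (x \<otimes> inv (r x) \<otimes> w x)" for x
    have wc: "w x \<in> carrier G" "r x \<in> carrier G" if "x \<in> ball n" for x
      using r[OF that] y ball_closed by (auto simp: w_def)
    have "h ` ball n \<subseteq> twisted_class G id ` ball (C * n)"
    proof
      fix T assume "T \<in> h ` ball n"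
      then obtain x where x: "x \<in> ball n" "T = h x" by blast
      have "x \<otimes> inv (r x) \<otimes> w x \<in> ball (n + n + (nat \<bar>N\<bar> * n + L))"
        unfolding w_def by (intro ball_mult ball_inv ball_pow x r L)
      moreover have "n + n + (nat \<bar>N\<bar> * n + L) \<le> C * n"
        using n by (simp add: C_def algebra_simps)
      ultimately have "x \<otimes> inv (r x) \<otimes> w x \<in> ball (C * n)" using product_ball_mono by blast
      then show "T \<in> twisted_class G id ` ball (C * n)" using x by (simp add: h_def)
    qed
    then have card_h: "card (h ` ball n) \<le> card (twisted_class G id ` ball (C * n))"
      by (intro card_mono finite_imageI finite_ball)
    have conj: "\<exists>g\<in>carrier G. z \<otimes> inv (r z) \<otimes> w z
        = zp (\<omega> g (x \<otimes> inv (r x) \<otimes> w x)) \<otimes> (x \<otimes> inv (r x) \<otimes> w x)"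
      if x: "x \<in> ball n" and z: "z \<in> ball n" and hz: "h z = h x" for x z
    proof -
      have c: "x \<otimes> inv (r x) \<otimes> w x \<in> carrier G" "z \<otimes> inv (r z) \<otimes> w z \<in> carrier G"
        using x z wc ball_closed by auto
      have "z \<otimes> inv (r z) \<otimes> w z \<in> h x"
        using twisted_class_id_self[OF c(2)] hz unfolding h_def by blast
      then obtain g where g: "g \<in> carrier G"
        "g \<otimes> (x \<otimes> inv (r x) \<otimes> w x) \<otimes> inv g = z \<otimes> inv (r z) \<otimes> w z"
        by (auto simp: h_def twisted_class_def)
      then show ?thesis using conj_eq[OF g(1) c(1)] by metis
    qed
    have "card (tw ` {z \<in> ball n. h z = h x}) \<le> m * card Tor" if x: "x \<in> ball n" for x
    proof -
      let ?X = "{z \<in> ball n. h z = h x}"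
      have "card (tw ` ?X) \<le> m * card (\<pi> ` ?X)"
      proof (rule card_image_le_fibres)
        show "finite ?X" using finite_ball by simp
        fix x' assume x': "x' \<in> ?X"
        then have x'_ball: "x' \<in> ball n" by blast
        define \<rho> where "\<rho> = r x'"
        define W where "W = w x'"
        have \<rho>: "\<rho> \<in> carrier G" and W: "W \<in> carrier G" "W = \<rho> [^] N \<otimes> y"
          using wc[OF x'_ball] by (auto simp: \<rho>_def W_def w_def)
        obtain k0 where k0: "x' = zp k0 \<otimes> \<rho>"
          using \<pi>_eq_imp[of x' \<rho>] r(2)[OF x'_ball] \<rho> x'_ball ball_closed by (auto simp: \<rho>_def)
        \<comment> \<open>The exponents by which ordinary conjugation can shift \<open>W\<close>;
          they form a subgroup of the integers, with generator \<open>d\<close>.\<close>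
        define \<Omega> where "\<Omega> = (\<lambda>g. \<omega> g W) ` carrier G"
        have zero: "0 \<in> \<Omega>" using \<omega>_self[OF W(1)] W(1) unfolding \<Omega>_def by (metis imageI)
        have diff: "a - b \<in> \<Omega>" if ab: "a \<in> \<Omega>" "b \<in> \<Omega>" for a b
        proof -
          obtain g g' where g: "g \<in> carrier G" "g' \<in> carrier G" "a = \<omega> g W" "b = \<omega> g' W"
            using ab unfolding \<Omega>_def by blast
          have "\<omega> (g \<otimes> g' [^] (- 1 :: int)) W = a - b"
            using g W(1) by (simp add: \<omega>_mult_left \<omega>_pow)
          then show ?thesis unfolding \<Omega>_def using g by (metis imageI int_pow_closed m_closed)
        qed
        have "\<exists>d\<in>\<Omega>. \<forall>e\<in>\<Omega>. d dvd e" by (rule int_subgroup_principal[OF zero diff]) blast+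
        then obtain d where d: "d \<in> \<Omega>" "\<And>e. e \<in> \<Omega> \<Longrightarrow> d dvd e" by blast
        obtain g0 where g0: "g0 \<in> carrier G" "\<omega> g0 W = d" using d(1) unfolding \<Omega>_def by blast
        \<comment> \<open>Conjugation by \<open>g0\<close> shifts \<open>W\<close> by
          \<open>d\<close>. The power \<open>m\<close> moves \<open>g0\<close> into
          \<open>Fix\<close>, and the power \<open>N\<close> supplies the factor relating twisted to
          ordinary shifts; the resulting twisted period is \<open>d * int m\<close>.\<close>
        define f where "f = (g0 [^] int m) [^] N"
        have g0m: "g0 [^] int m \<in> Fix" using m(2) g0 by blast
        then have f: "f \<in> Fix" unfolding f_def using subgroup_int_pow_closed[OF subgroup_Fix] by blast
        have "\<omega> f \<rho> + \<mu> f = N * \<omega> (g0 [^] int m) \<rho> + N * \<mu> (g0 [^] int m)"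
          using additive_on_int_pow[OF subgroup_Fix additive_\<mu> g0m, of N] g0 \<rho>
          by (simp add: f_def \<omega>_pow)
        also have "\<dots> = \<omega> (g0 [^] int m) W"
          using \<mu>[OF g0m] g0 \<rho> y by (simp add: W(2) \<omega>_mult_right \<omega>_pow)
        also have "\<dots> = d * int m" using g0 W(1) by (simp add: \<omega>_pow)
        finally have per: "f \<otimes> \<rho> \<otimes> inv (\<psi> f) = zp (d * int m) \<otimes> \<rho>"
          using Fix_twist[OF f \<rho>] by simp
        \<comment> \<open>Within the fibre, a common value of \<open>h\<close> fixes the exponent
          modulo \<open>d\<close>, and the period \<open>d * int m\<close> leaves \<open>m\<close>
          possibilities.\<close>
        have "tw ` {z \<in> ?X. \<pi> z = \<pi> x'} \<subseteq> (\<lambda>s. tw (zp (k0 + d * s) \<otimes> \<rho>)) ` {0..<int m}"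
        proof
          fix T assume "T \<in> tw ` {z \<in> ?X. \<pi> z = \<pi> x'}"
          then obtain z where z: "T = tw z" "z \<in> ball n" "h z = h x'" "\<pi> z = \<pi> x'" using x' by auto
          have rz: "r z = \<rho>" "w z = W" using z(4) by (simp_all add: \<rho>_def W_def w_def r_def)
          obtain k where k: "z = zp k \<otimes> \<rho>"
            using \<pi>_eq_imp[of z \<rho>] z(2,4) r(2)[OF x'_ball] \<rho> ball_closed by (auto simp: \<rho>_def)
          obtain g where g: "g \<in> carrier G" "z \<otimes> inv (r z) \<otimes> w z
              = zp (\<omega> g (x' \<otimes> inv (r x') \<otimes> w x')) \<otimes> (x' \<otimes> inv (r x') \<otimes> w x')"
            using conj[OF x'_ball z(2,3)] by blast
          have cancel: "zp e \<otimes> \<rho> \<otimes> inv \<rho> = zp e" for e using \<rho> by (simp add: m_assoc)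
          have e1: "z \<otimes> inv (r z) \<otimes> w z = zp k \<otimes> W"
            unfolding rz by (subst k) (simp only: cancel)
          have e2: "x' \<otimes> inv (r x') \<otimes> w x' = zp k0 \<otimes> W"
            unfolding \<rho>_def[symmetric] W_def[symmetric] by (subst k0) (simp only: cancel)
          have "zp k \<otimes> W = zp (\<omega> g W + k0) \<otimes> W"
            using g(2) unfolding e1 e2 using g(1) W(1) by (simp add: \<omega>_mult_right zp_zp_left)
          then have "k = \<omega> g W + k0" using W(1) by simp
          moreover have "d dvd \<omega> g W" using d(2) g(1) unfolding \<Omega>_def by blast
          ultimately obtain t where t: "k = k0 + d * t" by (metis add.commute dvdE)
          have "t = t mod int m + int m * (t div int m)" by simp
          then have "d * t = d * (t mod int m) + d * int m * (t div int m)"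
            by (metis distrib_left mult.assoc)
          then have kt: "k = k0 + d * (t mod int m) + d * int m * (t div int m)" using t by linarith
          have "T = tw (zp k \<otimes> \<rho>)" using z(1) k by simp
          also have "\<dots> = tw (zp (k0 + d * (t mod int m)) \<otimes> \<rho>)"
            unfolding kt by (rule tw_period[OF \<rho> Fix_closed[OF f] per])
          finally have "T = tw (zp (k0 + d * (t mod int m)) \<otimes> \<rho>)" .
          moreover have "t mod int m \<in> {0..<int m}" using m(1) by simp
          ultimately show "T \<in> (\<lambda>s. tw (zp (k0 + d * s) \<otimes> \<rho>)) ` {0..<int m}" by blast
        qed
        then have "card (tw ` {z \<in> ?X. \<pi> z = \<pi> x'}) \<le> card {0..<int m}"
          by (meson card_image_le card_mono finite_atLeastLessThan_int finite_imageI order_trans)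
        then show "card (tw ` {z \<in> ?X. \<pi> z = \<pi> x'}) \<le> m" by simp
      qed
      \<comment> \<open>Conjugation does not change \<pi>, so equal values of \<open>h\<close> give
        \<open>\<pi> z\<close> and \<open>\<pi> x\<close> the same \<open>N\<close>-th
        power.\<close>
      also have "card (\<pi> ` ?X) \<le> card Tor"
      proof -
        have xc: "x \<in> carrier G" using x by (rule ball_closed)
        have "\<pi> ` ?X \<subseteq> (\<lambda>q. q \<otimes>\<^bsub>Q\<^esub> \<pi> x) ` Tor"
        proof
          fix q assume "q \<in> \<pi> ` ?X"
          then obtain z where z: "z \<in> ball n" "h z = h x" "q = \<pi> z" by blast
          have zc: "z \<in> carrier G" using z by (auto intro: ball_closed)
          obtain g where g: "g \<in> carrier G" "z \<otimes> inv (r z) \<otimes> w z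
              = zp (\<omega> g (x \<otimes> inv (r x) \<otimes> w x)) \<otimes> (x \<otimes> inv (r x) \<otimes> w x)"
            using conj[OF x z(1,2)] by blast
          have \<pi>w: "\<pi> (u \<otimes> inv (r u) \<otimes> w u) = \<pi> u [^]\<^bsub>Q\<^esub> N \<otimes>\<^bsub>Q\<^esub> \<pi> y" if u: "u \<in> ball n" for u
          proof -
            have "u \<in> carrier G" using u by (rule ball_closed)
            then show ?thesis
              using wc[OF u] r(2)[OF u] y by (simp add: w_def \<pi>.hom_int_pow)
          qed
          have X: "x \<otimes> inv (r x) \<otimes> w x \<in> carrier G" using wc[OF x] xc by simp
          have "\<pi> z [^]\<^bsub>Q\<^esub> N \<otimes>\<^bsub>Q\<^esub> \<pi> y = \<pi> (z \<otimes> inv (r z) \<otimes> w z)"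
            by (rule \<pi>w[OF z(1), symmetric])
          also have "\<dots> = \<pi> (x \<otimes> inv (r x) \<otimes> w x)"
            unfolding g(2) \<pi>.hom_mult[OF zp_closed X] \<pi>_zp by (rule Q.l_one[OF \<pi>.hom_closed[OF X]])
          also have "\<dots> = \<pi> x [^]\<^bsub>Q\<^esub> N \<otimes>\<^bsub>Q\<^esub> \<pi> y" by (rule \<pi>w[OF x])
          finally have "\<pi> z [^]\<^bsub>Q\<^esub> N \<otimes>\<^bsub>Q\<^esub> \<pi> y = \<pi> x [^]\<^bsub>Q\<^esub> N \<otimes>\<^bsub>Q\<^esub> \<pi> y" .
          then have "\<pi> z [^]\<^bsub>Q\<^esub> N = \<pi> x [^]\<^bsub>Q\<^esub> N" using zc xc y by simp
          then have "(\<pi> z \<otimes>\<^bsub>Q\<^esub> inv\<^bsub>Q\<^esub> \<pi> x) [^]\<^bsub>Q\<^esub> N = \<one>\<^bsub>Q\<^esub>"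
            using zc xc by (simp add: Q.int_pow_distrib Q.int_pow_inv)
          then have "\<pi> z \<otimes>\<^bsub>Q\<^esub> inv\<^bsub>Q\<^esub> \<pi> x \<in> Tor" using zc xc by (simp add: Tor_def)
          moreover have "q = \<pi> z \<otimes>\<^bsub>Q\<^esub> inv\<^bsub>Q\<^esub> \<pi> x \<otimes>\<^bsub>Q\<^esub> \<pi> x" using z(3) zc xc by (simp add: Q.m_assoc)
          ultimately show "q \<in> (\<lambda>q. q \<otimes>\<^bsub>Q\<^esub> \<pi> x) ` Tor" by blast
        qed
        then show ?thesis using Tor by (meson card_image_le card_mono finite_imageI order_trans)
      qed
      finally show ?thesis by (simp add: mult_le_mono2)
    qed
    from card_image_le_fibres[OF finite_ball this]
    show ?thesis using card_h by (meson mult_le_mono2 order_trans)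
  qed
  note main = this
  define D where "D = m * card Tor + C"
  have "card (tw ` ball n) \<le> D * card (twisted_class G id ` ball (D * n))" if "n \<ge> 1" for n
  proof -
    have "card (twisted_class G id ` ball (C * n)) \<le> card (twisted_class G id ` ball (D * n))"
      by (intro card_mono image_mono product_ball_mono finite_imageI finite_ball) (simp add: D_def)
    then have "(m * card Tor) * card (twisted_class G id ` ball (C * n))
        \<le> D * card (twisted_class G id ` ball (D * n))"
      by (intro mult_le_mono) (auto simp: D_def)
    then show ?thesis using main[OF that] by (rule order_trans[rotated])
  qed
  then show ?thesis by blast
qed

text \<open>The case distinction. The elements \<open>u\<close> and \<open>v\<close> witness that
  \<open>G\<close> is not abelian and serve as the two directions when all of \<open>Fix\<close> is
  central.\<close>

theorem twisted_growth_bound: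
  assumes "u \<in> carrier G" "v \<in> carrier G" "\<omega> u v \<noteq> 0"
  shows "\<exists>C. \<forall>n\<ge>1. card (tw ` ball n) \<le> C * card (twisted_class G id ` ball (C * n))"
proof -
  have via_\<pi>: ?thesis if ex: "\<exists>C. \<forall>n\<ge>1. card (tw ` ball n) \<le> C * card (\<pi> ` ball (C * n))"
  proof -
    obtain C where C: "\<And>n. n \<ge> 1 \<Longrightarrow> card (tw ` ball n) \<le> C * card (\<pi> ` ball (C * n))"
      using ex by blast
    have "card (tw ` ball n) \<le> C * card (twisted_class G id ` ball (C * n))" if "n \<ge> 1" for n
      using C[OF that] mult_le_mono2[OF card_\<pi>_ball_le[of "C * n"], of C] by linarith
    then show ?thesis by blast
  qed
  show ?thesis
  proof (cases "\<exists>f\<in>Fix. f \<in> group_center G \<and> \<mu> f \<noteq> 0")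
    case True
    then obtain f where f: "f \<in> Fix" "f \<in> group_center G" "\<mu> f \<noteq> 0" by blast
    have "card (tw ` ball n) \<le> nat \<bar>\<mu> f\<bar> * card (\<pi> ` ball (nat \<bar>\<mu> f\<bar> * n))" for n
    proof -
      have "1 * n \<le> nat \<bar>\<mu> f\<bar> * n" using f(3) by (intro mult_le_mono1) linarith
      then have "n \<le> nat \<bar>\<mu> f\<bar> * n" by simp
      then show ?thesis
        using growth_central_twist[OF f, of n] \<pi>_ball_mono mult_le_mono2 order_trans by meson
    qed
    then show ?thesis using via_\<pi> by blast
  next
    case False
    then have central: "\<And>f. f \<in> Fix \<Longrightarrow> f \<in> group_center G \<Longrightarrow> \<mu> f = 0" by blast
    \<comment> \<open>The element \<open>c\<close> is itself central and in \<open>Fix\<close>, so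
      \<open>\<mu> c = 1 - \<epsilon>\<close> vanishes.\<close>
    have \<epsilon>: "\<epsilon> = 1" using central[of c] zp_Fix[of 1] c_center \<mu>_c by (simp add: zp_1)
    show ?thesis
    proof (cases "\<forall>a\<in>carrier G. \<exists>k::int. E a [^]\<^bsub>Q\<^esub> k = \<one>\<^bsub>Q\<^esub> \<and> k \<noteq> 0")
      case True
      then obtain m :: nat where "m > 0" "\<And>g. g \<in> carrier G \<Longrightarrow> g [^] int m \<in> Fix"
        using uniform_E_torsion by blast
      then show ?thesis using growth_finite_order[OF central] by blast
    next
      case False
      then obtain a where a: "a \<in> carrier G" "\<And>k::int. E a [^]\<^bsub>Q\<^esub> k = \<one>\<^bsub>Q\<^esub> \<Longrightarrow> k = 0" by blast
      show ?thesis
      proof (cases "Fix \<subseteq> group_center G")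
        case True
        then show ?thesis using via_\<pi> growth_fixed_central assms by blast
      next
        case False
        then obtain f where f: "f \<in> Fix" "f \<notin> group_center G" by blast
        have fc: "f \<in> carrier G" using f(1) by (rule Fix_closed)
        obtain x where x: "x \<in> carrier G" "f \<otimes> x \<noteq> x \<otimes> f" using f(2) fc by (auto simp: group_center_def)
        have "\<omega> f x \<noteq> 0" using \<omega>_commute[OF fc x(1)] x fc by auto
        then show ?thesis using via_\<pi> growth_noncentral_fixed[OF \<epsilon> f(1) x(1) _ a] by blast
      qed
    qed
  qed
qed

end

section \<open>Application to the derived subgroup\<close>

lemma (in group) infinite_range_int_pow:
  assumes "x \<in> carrier G" "infinite (range (\<lambda>k::int. x [^] k))" "x [^] (k::int) = \<one>"
  shows "k = 0"
proof (rule ccontr)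
  assume k: "k \<noteq> 0"
  \<comment> \<open>With \<open>x [^] k = \<one>\<close> and \<open>k \<noteq> 0\<close>, all powers
    of \<open>x\<close> have exponents in a finite range, against infinity of the set of
    powers.\<close>
  have "x [^] i = x [^] (i mod k)" for i :: int
  proof -
    have "x [^] i = x [^] (k * (i div k) + i mod k)" by simp
    also have "\<dots> = (x [^] k) [^] (i div k) \<otimes> x [^] (i mod k)"
      using assms(1) by (simp only: int_pow_mult int_pow_pow)
    finally show ?thesis using assms by simp
  qed
  moreover have "i mod k \<in> {- \<bar>k\<bar>..\<bar>k\<bar>}" for i using abs_mod_less[OF k, of i] by auto
  ultimately have "range (\<lambda>i::int. x [^] i) \<subseteq> (\<lambda>i. x [^] i) ` {- \<bar>k\<bar>..\<bar>k\<bar>}" by blast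
  moreover have "finite ((\<lambda>i. x [^] i) ` {- \<bar>k\<bar>..\<bar>k\<bar>})" by blast
  ultimately show False using assms(2) finite_subset by blast
qed

text \<open>The extension is instantiated with the projection from \<open>G\<close> to its
  abelianisation and a generator \<open>c\<close> of the derived subgroup. A homomorphism maps the
  derived subgroup into itself, so \<open>\<psi> c\<close> is a power of \<open>c\<close>.\<close>

theorem (in group) twisted_growth_endomorphism_le:
  fixes \<psi> :: "'a \<Rightarrow> 'a"
  assumes S: "finite_generating_set G S" and T: "finite_generating_set G T"
    and nilpotent: "two_step_nilpotent G"
    and cyclic: "infinite_cyclic_group (subgroup_generated G (derived G (carrier G)))"
    and hom: "\<psi> \<in> hom G G"
  shows "(\<lambda>n. real (twisted_growth G S \<psi> n)) \<prec> (\<lambda>n. real (conjugacy_growth G T n))"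
proof -
  define D where "D = derived G (carrier G)"
  have D: "subgroup D G" unfolding D_def by (rule derived_is_subgroup[OF subset_refl])
  interpret H: group "subgroup_generated G D" by (rule group_subgroup_generated)
  have carrier_H: "carrier (subgroup_generated G D) = D"
    using D by (rule subgroup.carrier_subgroup_generated_subgroup)
  obtain c where c: "c \<in> D" "D = range (\<lambda>k::int. c [^] k)"
  proof -
    obtain c where "c \<in> D" "D = range (\<lambda>k::int. c [^]\<^bsub>subgroup_generated G D\<^esub> k)"
      using cyclic H.cyclic_group unfolding infinite_cyclic_group_def D_def[symmetric] carrier_H by auto
    then show ?thesis using that by (simp add: int_pow_subgroup_generated carrier_H)
  qed
  have inf_D: "infinite D"
    using cyclic unfolding infinite_cyclic_group_def D_def[symmetric] carrier_H by blast
  have cc: "c \<in> carrier G" using subgroup.mem_carrier[OF D c(1)] .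
  interpret \<psi>: group_hom G G \<psi> by unfold_locales (rule hom)
  have "\<psi> c \<in> derived G (\<psi> ` carrier G)"
    using c(1) \<psi>.derived_img[OF subset_refl] unfolding D_def by blast
  moreover have "\<psi> ` carrier G \<subseteq> carrier G" using \<psi>.hom_closed by blast
  ultimately have "\<psi> c \<in> D" unfolding D_def using mono_derived by blast
  then obtain \<epsilon> :: int where \<epsilon>: "\<psi> c = c [^] \<epsilon>" using c(2) by blast
  have normal: "D \<lhd> G" unfolding D_def by (rule derived_self_is_normal)
  interpret heisenberg_endomorphism G "G Mod D" "\<lambda>x. D #> x" c S \<psi> \<epsilon>
  proof (intro heisenberg_endomorphism.intro heisenberg_extension.intro
      heisenberg_extension_axioms.intro heisenberg_endomorphism_axioms.intro)
    show "group G" by (rule is_group)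
    show "comm_group (G Mod D)" unfolding D_def by (rule derived_quot_is_comm_group)
    show "finite_generating_set G S" by (rule S)
    show "(#>) D \<in> hom G (G Mod D)" using normal.r_coset_hom_Mod[OF normal] .
    show "(#>) D ` carrier G = carrier (G Mod D)" by (simp add: carrier_FactGroup)
    show "\<exists>k::int. x = c [^] k" if "x \<in> carrier G" "D #> x = \<one>\<^bsub>G Mod D\<^esub>" for x
      using coset_join1[OF _ that(1) D] that(2) c(2) by auto
    show "D #> c = \<one>\<^bsub>G Mod D\<^esub>" using coset_join2[OF cc D c(1)] by simp
    show "c \<in> group_center G"
      using nilpotent c(1) unfolding two_step_nilpotent_def D_def by blast
    show "k = 0" if "c [^] k = \<one>" for k :: int
      using infinite_range_int_pow[OF cc _ that] inf_D c(2) by simp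
    show "\<psi> \<in> hom G G" by (rule hom)
    show "\<psi> c = c [^] \<epsilon>" by (rule \<epsilon>)
  qed
  \<comment> \<open>If \<omega> vanished, \<open>G\<close> would be abelian and its derived subgroup
    trivial rather than infinite.\<close>
  have "\<exists>u\<in>carrier G. \<exists>v\<in>carrier G. \<omega> u v \<noteq> 0"
  proof (rule ccontr)
    assume zero: "\<not> ?thesis"
    have "x \<otimes> y = y \<otimes> x" if "x \<in> carrier G" "y \<in> carrier G" for x y
      using \<omega>_commute[OF that] zero that by (metis l_one m_closed zp_0)
    then have "comm_group G" by (rule group_comm_groupI)
    then have "D = {\<one>}" unfolding D_def by (rule comm_group.derived_eq_singleton[OF _ subset_refl])
    then show False using inf_D by simp
  qed
  then obtain u v where uv: "u \<in> carrier G" "v \<in> carrier G" "\<omega> u v \<noteq> 0" by blast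
  obtain C where C: "\<And>n. n \<ge> 1 \<Longrightarrow>
      card (tw ` ball n) \<le> C * card (twisted_class G id ` ball (C * n))"
    using twisted_growth_bound[OF uv] by blast
  obtain k where k: "S \<subseteq> product_ball G T k"
    using finite_subset_product_ball[OF T S_finite S_closed] by blast
  have T_set: "T \<subseteq> carrier G" "finite T" using T by (auto simp: finite_generating_set_def)
  \<comment> \<open>One constant that is at least the factor \<open>C\<close>, the rescaling
    \<open>k * C\<close> of the radius, and 1.\<close>
  define K where "K = k * C + C + 1"
  have "twisted_growth G S \<psi> n \<le> K * conjugacy_growth G T (K * n)" if n: "n \<ge> 1" for n
  proof -
    have "ball (C * n) \<subseteq> product_ball G T (k * (C * n))" by (rule product_ball_scale[OF T_set(1) k])
    also have "\<dots> \<subseteq> product_ball G T (K * n)"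
      by (rule product_ball_mono) (simp add: K_def algebra_simps)
    finally have "card (twisted_class G id ` ball (C * n))
        \<le> card (twisted_class G id ` product_ball G T (K * n))"
      using finite_product_ball[OF T_set(2)] by (intro card_mono image_mono) auto
    also have "\<dots> = conjugacy_growth G T (K * n)"
      by (simp add: conjugacy_growth_eq_twisted_growth_id twisted_growth_def
          word_ball_eq_product_ball[OF T])
    finally have "C * card (twisted_class G id ` ball (C * n)) \<le> K * conjugacy_growth G T (K * n)"
      by (intro mult_le_mono) (simp_all add: K_def)
    then show ?thesis
      using C[OF n] by (simp add: twisted_growth_def word_ball_eq_product_ball[OF S])
  qed
  then have "\<forall>n\<ge>1. real (twisted_growth G S \<psi> n) \<le> real K * real (conjugacy_growth G T (K * n))"
    by (metis of_nat_le_iff of_nat_mult)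
  moreover have "K \<ge> 1" by (simp add: K_def)
  ultimately show ?thesis unfolding growth_le_def by blast
qed

text \<open>Separate generating sets \<open>S\<close> and \<open>T\<close> on the two sides make
  independence of the relation from their choice part of the result.\<close>

theorem corollary1:
  fixes G :: "('a, 'b) monoid_scheme" and \<psi> :: "'a \<Rightarrow> 'a" and S T :: "'a set"
  assumes "group G"
    and "finite_generating_set G S" and "finite_generating_set G T"
    and "two_step_nilpotent G"
    and "infinite_cyclic_group (subgroup_generated G (derived G (carrier G)))"
    and "\<psi> \<in> iso G G"
  shows "(\<lambda>n. real (twisted_growth G S \<psi> n)) \<prec> (\<lambda>n. real (conjugacy_growth G T n))"
  using group.twisted_growth_endomorphism_le[OF assms(1-5)] assms(6) by (simp add: iso_def)

end
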